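(* Suppose the number of hidden nodes satisfies $k_n \sim n^a$ for some $0<a<1$. In addition, suppose assumptions (A1) and (A2) hold for some $0\leq \delta<1-a$. Then, with the normal prior for each entry of $\boldsymbol{\omega}_n=\boldsymbol{\theta}_n$, $$p(\boldsymbol{\omega}_n)=\prod_{i=1}^{K(n)}\frac{1}{\sqrt{2\pi \zeta^2}}e^{-\frac{\theta_{in}^2}{2\zeta^2}},$$ we have, for every $\varepsilon>0$, $$\pi^*(\mathcal{V}_\varepsilon^c)=o_{P_0^n}(n^{-\delta}).$$
   Context: Data: $y_i=f_0(\boldsymbol{x}_i)+\xi_i$, $i=1,\dots,n$, with $\xi_i$ i.i.d. $N(0,\sigma_0^2)$, $\sigma_0$ known, and $\boldsymbol{x}_i\sim U(0,1)^p$ with $p$ fixed; $P_0^n$ is the true data distribution. The true conditional density is $l_0(y,\boldsymbol{x})=\frac{1}{\sqrt{2\pi\sigma_0^2}}\exp(-\frac{1}{2\sigma_0^2}(y-f_0(\boldsymbol{x}))^2)$. The model is the one-hidden-layer neural network $f_{\boldsymbol{\theta}_n}(\boldsymbol{x})=\beta_0+\sum_{j=1}^{k_n}\beta_j\psi(\gamma_j^\top\boldsymbol{x})$ with logistic $\psi(u)=1/(1+e^{-u})$, parameter vector $\boldsymbol{\theta}_n=(\beta_j,\gamma_{jh})$ of dimension $K(n)=1+k_n(p+1)$, and density $l_{\boldsymbol{\omega}_n}(y,\boldsymbol{x})=\frac{1}{\sqrt{2\pi\sigma_0^2}}\exp(-\frac{1}{2\sigma_0^2}(y-f_{\boldsymbol{\theta}_n}(\boldsymbol{x}))^2)$;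 likelihood $L(\boldsymbol{\omega}_n)=\prod_i l_{\boldsymbol{\omega}_n}(y_i,\boldsymbol{x}_i)$ and posterior $\pi(\cdot|\boldsymbol{y}_n,\boldsymbol{X}_n)\propto L(\boldsymbol{\omega}_n)p(\boldsymbol{\omega}_n)$. Assumption (A1): there is a neural network $f_{\boldsymbol{\theta}_{0n}}$ with $k_n$ nodes such that $\|f_{\boldsymbol{\theta}_{0n}}-f_0\|_2=o(n^{-\delta})$. Assumption (A2): its coefficients satisfy $\sum_{i=1}^{K(n)}\theta_{i0n}^2=o(n^{1-\delta})$. Variational family (Gaussian mean field): $\mathcal{Q}_n=\{q(\boldsymbol{\omega}_n)=\prod_{i=1}^{K(n)}N(\theta_{in};\tilde m_{in},\tilde s_{in}^2)\}$, and the variational posterior is $\pi^*=\arg\min_{q\in\mathcal{Q}_n} d_{KL}(q,\pi(\cdot|\boldsymbol{y}_n,\boldsymbol{X}_n))$. Hellinger neighborhood: $\mathcal{V}_\varepsilon=\{\boldsymbol{\omega}_n: d_H(l_0,l_{\boldsymbol{\omega}_n})<\varepsilon\}$ with $d_H(l_0,l_{\boldsymbol{\omega}_n})=\int\int(\sqrt{l_{\boldsymbol{\omega}_n}(\boldsymbol{x},y)}-\sqrt{l_0(\boldsymbol{x},y)})^2d\boldsymbol{x}\,dy$. *)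

theory Defs
  imports "HOL-Probability.Probability" "HOL-Library.Landau_Symbols"
begin

definition logistic :: "real \<Rightarrow> real" where
  "logistic u = 1 / (1 + exp (- u))"

definition nparams :: "nat \<Rightarrow> nat \<Rightarrow> nat" where
  "nparams p k = 1 + k * (p + 1)"

text \<open>One-hidden-layer network. Parameter vector theta indexed by 0..K-1:
  theta 0 = beta_0, theta j = beta_j (1 \<le> j \<le> k),
  theta (k + (j-1)*p + 1 + h) = gamma_{j h} (1 \<le> j \<le> k, h < p).
  Inputs x are vectors indexed by 0..p-1.\<close>
definition nnet :: "nat \<Rightarrow> nat \<Rightarrow> (nat \<Rightarrow> real) \<Rightarrow> (nat \<Rightarrow> real) \<Rightarrow> real" where
  "nnet p k \<theta> x = \<theta> 0 + (\<Sum>j\<in>{1..k}. \<theta> j *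
      logistic (\<Sum>h<p. \<theta> (k + (j - 1) * p + 1 + h) * x h))"

definition covariate_measure :: "nat \<Rightarrow> (nat \<Rightarrow> real) measure" where
  "covariate_measure p = PiM {..<p} (\<lambda>_. uniform_measure lborel {0..1::real})"

definition true_obs_measure :: "nat \<Rightarrow> ((nat \<Rightarrow> real) \<Rightarrow> real) \<Rightarrow> real \<Rightarrow> ((nat \<Rightarrow> real) \<times> real) measure" where
  "true_obs_measure p f0 \<sigma>0 =
     density (covariate_measure p \<Otimes>\<^sub>M lborel) (\<lambda>(x, y). ennreal (normal_density (f0 x) \<sigma>0 y))"

definition true_data_measure :: "nat \<Rightarrow> ((nat \<Rightarrow> real) \<Rightarrow> real) \<Rightarrow> real \<Rightarrow> nat \<Rightarrow> (nat \<Rightarrow> (nat \<Rightarrow> real) \<times> real) measure" where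
  "true_data_measure p f0 \<sigma>0 n = PiM {..<n} (\<lambda>_. true_obs_measure p f0 \<sigma>0)"

definition param_space :: "nat \<Rightarrow> (nat \<Rightarrow> real) measure" where
  "param_space K = PiM {..<K} (\<lambda>_. lborel)"

definition normal_prior :: "real \<Rightarrow> nat \<Rightarrow> (nat \<Rightarrow> real) measure" where
  "normal_prior \<zeta> K = PiM {..<K} (\<lambda>_. density lborel (\<lambda>t. ennreal (normal_density 0 \<zeta> t)))"

definition likelihood :: "nat \<Rightarrow> nat \<Rightarrow> real \<Rightarrow> nat \<Rightarrow> (nat \<Rightarrow> real) \<Rightarrow> (nat \<Rightarrow> (nat \<Rightarrow> real) \<times> real) \<Rightarrow> real" where
  "likelihood p k \<sigma>0 n \<theta> D = (\<Prod>i<n. normal_density (nnet p k \<theta> (fst (D i))) \<sigma>0 (snd (D i)))"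

definition posterior :: "nat \<Rightarrow> nat \<Rightarrow> real \<Rightarrow> real \<Rightarrow> nat \<Rightarrow> (nat \<Rightarrow> (nat \<Rightarrow> real) \<times> real) \<Rightarrow> (nat \<Rightarrow> real) measure" where
  "posterior p k \<sigma>0 \<zeta> n D =
     (let pr = normal_prior \<zeta> (nparams p k);
          Z = (\<integral>\<theta>. likelihood p k \<sigma>0 n \<theta> D \<partial>pr)
      in density pr (\<lambda>\<theta>. ennreal (likelihood p k \<sigma>0 n \<theta> D / Z)))"

definition mean_field_family :: "nat \<Rightarrow> (nat \<Rightarrow> real) measure set" where
  "mean_field_family K =
     {PiM {..<K} (\<lambda>i. density lborel (\<lambda>t. ennreal (normal_density (m i) (s i) t))) | m s.
        \<forall>i<K. 0 < s i}"

text \<open>d_KL(q, pi) = \<integral> log (dq/dpi) dq, via the library's KL divergence (natural log).\<close>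
definition dKL :: "'a measure \<Rightarrow> 'a measure \<Rightarrow> real" where
  "dKL q \<pi> = KL_divergence (exp 1) \<pi> q"

definition hellinger :: "nat \<Rightarrow> nat \<Rightarrow> ((nat \<Rightarrow> real) \<Rightarrow> real) \<Rightarrow> real \<Rightarrow> (nat \<Rightarrow> real) \<Rightarrow> real" where
  "hellinger p k f0 \<sigma>0 \<theta> = enn2real (\<integral>\<^sup>+ (x, y).
      ennreal ((sqrt (normal_density (nnet p k \<theta> x) \<sigma>0 y) - sqrt (normal_density (f0 x) \<sigma>0 y))\<^sup>2)
      \<partial>(covariate_measure p \<Otimes>\<^sub>M lborel))"

definition hellinger_nbhd :: "nat \<Rightarrow> nat \<Rightarrow> ((nat \<Rightarrow> real) \<Rightarrow> real) \<Rightarrow> real \<Rightarrow> real \<Rightarrow> (nat \<Rightarrow> real) set" where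
  "hellinger_nbhd p k f0 \<sigma>0 \<epsilon> = {\<theta> \<in> space (param_space (nparams p k)). hellinger p k f0 \<sigma>0 \<theta> < \<epsilon>}"

definition outer_prob :: "'a measure \<Rightarrow> 'a set \<Rightarrow> real" where
  "outer_prob M A = Inf {measure M B | B. B \<in> sets M \<and> A \<subseteq> B}"

definition little_o_prob :: "(nat \<Rightarrow> 'a measure) \<Rightarrow> (nat \<Rightarrow> 'a \<Rightarrow> real) \<Rightarrow> (nat \<Rightarrow> real) \<Rightarrow> bool" where
  "little_o_prob P X r \<longleftrightarrow>
     (\<forall>\<eta>>0. (\<lambda>n. outer_prob (P n) {D \<in> space (P n). \<eta> \<le> \<bar>X n D / r n\<bar>}) \<longlonglongrightarrow> 0)"

definition L2_dist_sq :: "nat \<Rightarrow> ((nat \<Rightarrow> real) \<Rightarrow> real) \<Rightarrow> ((nat \<Rightarrow> real) \<Rightarrow> real) \<Rightarrow> ennreal" where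
  "L2_dist_sq p f g = (\<integral>\<^sup>+ x. ennreal ((f x - g x)\<^sup>2) \<partial>covariate_measure p)"

end

theory Submission
  imports Defs "HOL-Real_Asymp.Real_Asymp"
begin

text \<open>
  Write \<open>l\<close> for the log-likelihood ratio \<open>ln (L / L0)\<close>. Up to a constant depending only on the data,
  \<open>KL(q, posterior)\<close> equals the loss \<open>J(q) = KL(q, prior) - \<integral>l dq\<close>. By the Donsker--Varadhan inequality,
  \<open>c * q(A) \<le> J(q) + ln M\<close> whenever the prior integral of \<open>exp (c * indicator A + l)\<close> is at most \<open>M\<close>.
  Apply this to the minimiser, with \<open>A\<close> the complement of the Hellinger neighbourhood and
  \<open>c = n * \<epsilon> / 8\<close>. Minimality replaces \<open>J(q)\<close> by its value at the Gaussian product centred at \<open>\<theta>0\<close>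
  with standard deviation \<open>n\<close> to the power \<open>-4\<close>, which is \<open>o(n powr (1 - \<delta>))\<close> in probability.
  The prior integral is at most \<open>n + 1\<close> with probability tending to one: outside the box
  \<open>\<bar>\<theta> i\<bar> \<le> n\<close> the prior mass is super-exponentially small, and the part of \<open>A\<close> inside the box is covered
  by \<open>exp (o(n))\<close> small cubes, on each of which the supremum of \<open>sqrt (L / L0)\<close> has expectation at most
  \<open>exp (- n * \<epsilon> / 8)\<close>.
\<close>

section \<open>Logistic networks\<close>

text \<open>Averaging over the data cannot control the tilted prior integral on A: L / L0 has mean
  one at every parameter, however far from the truth, so the factor exp c would survive. Only sqrt
  (L / L0) has an exponentially small mean, the n-th power of the Gaussian affinity. This forces a
  bound in probability, uniform over parameters, hence the net and the brackets. Outside the box no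
  such uniformity is available, but there the prior tail pays for exp c. As \<open>hellinger\<close>
  takes no square root, \<epsilon> enters the exponents linearly. Dividing a loss of order o(n powr
  (1 - \<delta>)) by c, which is linear in n, gives the rate. The competitor pays a logarithm per
  coordinate for its concentration, and n powr a * ln n is o(n powr (1 - \<delta>)) because \<delta>
  < 1 - a. Its likelihood loss is bounded by the inequalities of Young and Markov, with no
  cancellation among the noise terms; the price is that the approximation error enters unsquared,
  which (A1) permits.\<close>

lemma logistic_bounds: "0 < logistic u" "logistic u < 1"
  by (simp_all add: logistic_def add_pos_pos)

text \<open>The derivative is psi * (1 - psi). The crude constant 1 is enough, because Lipschitz
  constants of networks matter only up to powers of n.\<close>

lemma logistic_lipschitz: "\<bar>logistic u - logistic v\<bar> \<le> \<bar>u - v\<bar>"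
proof -
  have der: "(logistic has_field_derivative exp (- x) / (1 + exp (- x))\<^sup>2) (at x within UNIV)" for x :: real
  proof -
    have "1 + exp (- x) \<noteq> 0"
      by (smt (verit) exp_gt_zero)
    then show ?thesis
      unfolding logistic_def[abs_def]
      by (auto intro!: derivative_eq_intros simp: power2_eq_square)
  qed
  have bnd: "norm (exp (- x) / (1 + exp (- x))\<^sup>2) \<le> 1" for x :: real
  proof -
    have "exp (- x) \<le> (1 + exp (- x))\<^sup>2"
      using exp_gt_zero[of "- x"] by (simp add: power2_eq_square algebra_simps)
    moreover have "0 < (1 + exp (- x))\<^sup>2"
      by (smt (verit) exp_gt_zero zero_less_power2)
    ultimately show ?thesis
      by simp
  qed
  show ?thesis
    using field_differentiable_bound[OF convex_UNIV der bnd, of u v] by simp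
qed

text \<open>The flat index range is beta_0, then k output weights, then k consecutive blocks of p
  input weights. The network estimates below arise block by block, and this puts them back into one
  sum over all parameters, the form in which nets and Gaussian moments are counted.\<close>

lemma sum_nparams:
  fixes g :: "nat \<Rightarrow> 'a::comm_monoid_add"
  shows "(\<Sum>i<nparams p k. g i) =
    g 0 + (\<Sum>j\<in>{1..k}. g j) + (\<Sum>j\<in>{1..k}. \<Sum>h<p. g (k + (j - 1) * p + 1 + h))"
proof -
  have K: "{..<nparams p k} = {..<Suc k} \<union> {Suc k..<Suc k + k * p}"
    by (auto simp: nparams_def)
  have "(\<Sum>i<nparams p k. g i) = (\<Sum>i<Suc k. g i) + (\<Sum>i\<in>{Suc k..<Suc k + k * p}. g i)"
    unfolding K by (rule sum.union_disjoint) auto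
  also have "(\<Sum>i<Suc k. g i) = g 0 + (\<Sum>j\<in>{1..k}. g j)"
    by (subst sum.lessThan_Suc_shift) (simp add: sum.atLeast1_atMost_eq)
  also have "(\<Sum>i\<in>{Suc k..<Suc k + k * p}. g i) = (\<Sum>i<k * p. g (i + Suc k))"
    using sum.shift_bounds_nat_ivl[of g 0 "Suc k" "k * p"] by (simp add: lessThan_atLeast0 add.commute)
  also have "\<dots> = (\<Sum>j<k. \<Sum>i = j * p..<j * p + p. g (i + Suc k))"
    by (rule sum.nat_group[symmetric])
  also have "\<dots> = (\<Sum>j<k. \<Sum>h<p. g (k + j * p + 1 + h))"
  proof (rule sum.cong[OF refl])
    fix j
    show "(\<Sum>i = j * p..<j * p + p. g (i + Suc k)) = (\<Sum>h<p. g (k + j * p + 1 + h))"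
      using sum.shift_bounds_nat_ivl[of "\<lambda>i. g (i + Suc k)" 0 "j * p" p]
      by (simp add: lessThan_atLeast0 algebra_simps)
  qed
  also have "\<dots> = (\<Sum>j\<in>{1..k}. \<Sum>h<p. g (k + (j - 1) * p + 1 + h))"
    by (simp add: sum.atLeast1_atMost_eq)
  finally show ?thesis .
qed

lemma nnet_abs_le: "\<bar>nnet p k \<theta> x\<bar> \<le> (\<Sum>i<nparams p k. \<bar>\<theta> i\<bar>)"
proof -
  have "\<bar>nnet p k \<theta> x\<bar> \<le> \<bar>\<theta> 0\<bar> + (\<Sum>j\<in>{1..k}. \<bar>\<theta> j * logistic (\<Sum>h<p. \<theta> (k + (j - 1) * p + 1 + h) * x h)\<bar>)"
    unfolding nnet_def by (intro order_trans[OF abs_triangle_ineq] add_mono sum_abs order_refl)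
  also have "\<dots> \<le> \<bar>\<theta> 0\<bar> + (\<Sum>j\<in>{1..k}. \<bar>\<theta> j\<bar>)"
    using logistic_bounds by (intro add_mono sum_mono) (auto simp: abs_mult mult_left_le less_imp_le abs_of_pos)
  also have "\<dots> \<le> (\<Sum>i<nparams p k. \<bar>\<theta> i\<bar>)"
    unfolding sum_nparams by (simp add: sum_nonneg)
  finally show ?thesis .
qed

text \<open>Only \<open>\<theta>'\<close> is bounded: it will be a net point or the centre of a
  Gaussian, while a Gaussian draw \<open>\<theta>\<close> is unbounded. In the factor 1 + B, the 1
  comes from output weights and the B from input weights; inputs in the unit cube and a 1-Lipschitz
  activation add nothing further.\<close>

lemma nnet_lipschitz:
  assumes x: "\<And>h. h < p \<Longrightarrow> 0 \<le> x h \<and> x h \<le> 1"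
    and B: "\<And>j. j < nparams p k \<Longrightarrow> \<bar>\<theta>' j\<bar> \<le> B"
  shows "\<bar>nnet p k \<theta> x - nnet p k \<theta>' x\<bar> \<le> (1 + B) * (\<Sum>i<nparams p k. \<bar>\<theta> i - \<theta>' i\<bar>)"
proof -
  define d where "d i = \<bar>\<theta> i - \<theta>' i\<bar>" for i
  let ?u = "\<lambda>\<theta> j. \<Sum>h<p. \<theta> (k + (j - 1) * p + 1 + h) * x h"
  have B0: "0 \<le> B"
    using B[of 0] by (simp add: nparams_def)
  have dpos: "0 \<le> d i" for i
    by (simp add: d_def)
  have unit: "\<bar>\<theta> j * logistic (?u \<theta> j) - \<theta>' j * logistic (?u \<theta>' j)\<bar>
      \<le> d j + B * (\<Sum>h<p. d (k + (j - 1) * p + 1 + h))" if j: "j \<in> {1..k}" for j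
  proof -
    have jK: "j < nparams p k"
      using j by (auto simp: nparams_def)
    \<comment> \<open>The difference of products is split so that the change of the activation is
      multiplied by the bounded weight \<open>\<theta>' j\<close>; the other term only needs
      \<open>logistic\<close> to stay below 1.\<close>
    have split: "\<theta> j * logistic (?u \<theta> j) - \<theta>' j * logistic (?u \<theta>' j)
        = (\<theta> j - \<theta>' j) * logistic (?u \<theta> j) + \<theta>' j * (logistic (?u \<theta> j) - logistic (?u \<theta>' j))"
      by (simp add: algebra_simps)
    have le: "\<bar>\<theta> j * logistic (?u \<theta> j) - \<theta>' j * logistic (?u \<theta>' j)\<bar>
        \<le> d j * 1 + B * \<bar>?u \<theta> j - ?u \<theta>' j\<bar>"
      unfolding split using logistic_bounds[of "?u \<theta> j"] B[OF jK] B0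
      by (intro order_trans[OF abs_triangle_ineq] add_mono)
        (auto simp: abs_mult d_def intro!: mult_mono logistic_lipschitz mult_left_le)
    have u: "\<bar>?u \<theta> j - ?u \<theta>' j\<bar> \<le> (\<Sum>h<p. d (k + (j - 1) * p + 1 + h))"
    proof -
      have "\<bar>a * x h - a' * x h\<bar> \<le> \<bar>a - a'\<bar>" if "h < p" for a a' h
        using x[OF that] by (simp add: left_diff_distrib[symmetric] abs_mult mult_left_le)
      then show ?thesis
        unfolding sum_subtractf[symmetric] d_def
        by (intro order_trans[OF sum_abs] sum_mono) simp
    qed
    show ?thesis
      using le mult_left_mono[OF u B0] by linarith
  qed
  have split: "nnet p k \<theta> x - nnet p k \<theta>' x = (\<theta> 0 - \<theta>' 0)
      + (\<Sum>j\<in>{1..k}. \<theta> j * logistic (?u \<theta> j) - \<theta>' j * logistic (?u \<theta>' j))"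
    by (simp add: nnet_def sum_subtractf)
  have "\<bar>nnet p k \<theta> x - nnet p k \<theta>' x\<bar> \<le> d 0 + (\<Sum>j\<in>{1..k}. d j + B * (\<Sum>h<p. d (k + (j - 1) * p + 1 + h)))"
    unfolding split
    by (intro order_trans[OF abs_triangle_ineq] add_mono order_trans[OF sum_abs] sum_mono unit)
      (auto simp: d_def)
  also have "\<dots> = d 0 + (\<Sum>j\<in>{1..k}. d j) + B * (\<Sum>j\<in>{1..k}. \<Sum>h<p. d (k + (j - 1) * p + 1 + h))"
    by (simp add: sum.distrib sum_distrib_left)
  also have "\<dots> \<le> (1 + B) * (\<Sum>i<nparams p k. d i)"
    unfolding sum_nparams using B0 dpos
    by (simp add: distrib_left distrib_right sum_nonneg)
  finally show ?thesis
    by (simp add: d_def)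
qed

text \<open>Parameters and inputs may both depend on \<open>\<omega>\<close>, so one statement
  serves the network as a function of the covariates, of the parameters, and of both jointly, as
  Tonelli requires.\<close>

lemma nnet_measurable [measurable]:
  assumes \<theta>: "\<And>i. i < nparams p k \<Longrightarrow> (\<lambda>\<omega>. \<theta> \<omega> i) \<in> borel_measurable M"
    and x: "\<And>h. h < p \<Longrightarrow> (\<lambda>\<omega>. x \<omega> h) \<in> borel_measurable M"
  shows "(\<lambda>\<omega>. nnet p k (\<theta> \<omega>) (x \<omega>)) \<in> borel_measurable M"
proof -
  have 1: "j < nparams p k" if "j \<in> {1..k}" for j
    using that by (auto simp: nparams_def)
  have 2: "k + (j - 1) * p + 1 + h < nparams p k" if "j \<in> {1..k}" "h < p" for j h
  proof -
    have "(j - 1) * p + h < (j - 1) * p + p"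
      using that by simp
    also have "\<dots> = j * p"
      using that by (cases j) auto
    also have "\<dots> \<le> k * p"
      using that by simp
    finally show ?thesis
      by (simp add: nparams_def)
  qed
  have [measurable]: "(\<lambda>u. logistic u) \<in> borel_measurable borel"
    unfolding logistic_def[abs_def] by measurable
  have "(\<lambda>\<omega>. \<theta> \<omega> 0) \<in> borel_measurable M"
    by (rule \<theta>) (simp add: nparams_def)
  moreover have "(\<lambda>\<omega>. logistic (\<Sum>h<p. \<theta> \<omega> (k + (j - 1) * p + 1 + h) * x \<omega> h)) \<in> borel_measurable M"
    if "j \<in> {1..k}" for j
  proof (rule measurable_compose[where g = logistic and N = borel])
    show "(\<lambda>\<omega>. \<Sum>h<p. \<theta> \<omega> (k + (j - 1) * p + 1 + h) * x \<omega> h) \<in> borel_measurable M"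
      using \<theta>[OF 2[OF that]] x by (intro borel_measurable_sum borel_measurable_times) auto
  qed simp
  ultimately show ?thesis
    unfolding nnet_def using \<theta>[OF 1]
    by (intro borel_measurable_add borel_measurable_sum borel_measurable_times) auto
qed

section \<open>Gaussian integrals\<close>

text \<open>Completing the square: two parabolas add up to one parabola around the weighted mean
  \<open>c\<close>, plus a multiple of (m - m')^2. Equal weights give the Hellinger affinity,
  unequal ones the integral of a bracket.\<close>

lemma nn_integral_exp_neg_two_squares:
  fixes A B m m' :: real
  assumes A: "0 < A" and B: "0 \<le> B"
  shows "(\<integral>\<^sup>+y. ennreal (exp (- (A * (y - m)\<^sup>2) - B * (y - m')\<^sup>2)) \<partial>lborel)
    = ennreal (sqrt (pi / (A + B)) * exp (- (A * B / (A + B) * (m - m')\<^sup>2)))"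
proof -
  define s where "s = sqrt (1 / (2 * (A + B)))"
  define c where "c = (A * m + B * m') / (A + B)"
  define E where "E = sqrt (pi / (A + B)) * exp (- (A * B / (A + B) * (m - m')\<^sup>2))"
  have AB: "0 < A + B"
    using A B by simp
  have s: "0 < s" "s\<^sup>2 = 1 / (2 * (A + B))"
    using AB by (auto simp: s_def)
  have eq: "exp (- (A * (y - m)\<^sup>2) - B * (y - m')\<^sup>2) = E * normal_density c s y" for y
  proof -
    have "2 * pi * s\<^sup>2 = pi / (A + B)"
      using s AB by (simp add: field_simps)
    then have "E * normal_density c s y
        = exp (- (A * B / (A + B) * (m - m')\<^sup>2)) * exp (- (A + B) * (y - c)\<^sup>2)"
      using AB s(2) by (simp add: E_def normal_density_def) (simp add: field_simps)
    also have "\<dots> = exp (- (A * (y - m)\<^sup>2) - B * (y - m')\<^sup>2)"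
    proof -
      have "(A + B) * (y - c)\<^sup>2 = ((A + B) * (y - c))\<^sup>2 / (A + B)"
        using AB by (simp add: power2_eq_square)
      also have "(A + B) * (y - c) = A * (y - m) + B * (y - m')"
      proof -
        have "(A + B) * c = A * m + B * m'"
          using AB by (simp add: c_def)
        then show ?thesis
          by (simp add: algebra_simps)
      qed
      finally have "A * B / (A + B) * (m - m')\<^sup>2 + (A + B) * (y - c)\<^sup>2
          = (A * B * (m - m')\<^sup>2 + (A * (y - m) + B * (y - m'))\<^sup>2) / (A + B)"
        by (simp add: add_divide_distrib)
      also have "A * B * (m - m')\<^sup>2 + (A * (y - m) + B * (y - m'))\<^sup>2
          = (A + B) * (A * (y - m)\<^sup>2 + B * (y - m')\<^sup>2)"
        by (simp add: power2_eq_square algebra_simps)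
      finally have "A * B / (A + B) * (m - m')\<^sup>2 + (A + B) * (y - c)\<^sup>2 = A * (y - m)\<^sup>2 + B * (y - m')\<^sup>2"
        using AB by simp
      then show ?thesis
        by (simp add: exp_add[symmetric] algebra_simps)
    qed
    finally show ?thesis ..
  qed
  have "0 \<le> E"
    using AB by (simp add: E_def)
  then have "(\<integral>\<^sup>+y. ennreal (exp (- (A * (y - m)\<^sup>2) - B * (y - m')\<^sup>2)) \<partial>lborel)
      = ennreal E * (\<integral>\<^sup>+y. ennreal (normal_density c s y) \<partial>lborel)"
    unfolding eq by (subst nn_integral_cmult[symmetric]) (auto simp: ennreal_mult)
  also have "(\<integral>\<^sup>+y. ennreal (normal_density c s y) \<partial>lborel) = 1"
    using s by (subst nn_integral_eq_integral) auto
  finally show ?thesis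
    by (simp add: E_def)
qed

lemma nn_integral_normal_density:
  assumes "0 < \<sigma>"
  shows "(\<integral>\<^sup>+y. ennreal (normal_density \<mu> \<sigma> y) \<partial>lborel) = 1"
  using assms by (subst nn_integral_eq_integral) auto

lemma nn_integral_normal_density_square:
  assumes "0 < \<sigma>"
  shows "(\<integral>\<^sup>+y. ennreal (normal_density \<mu> \<sigma> y) * ennreal ((y - \<mu>)\<^sup>2) \<partial>lborel) = ennreal (\<sigma>\<^sup>2)"
proof -
  have "has_bochner_integral lborel (\<lambda>x. normal_density \<mu> \<sigma> x * (x - \<mu>)\<^sup>2) (\<sigma>\<^sup>2)"
    using normal_moment_even[OF assms, of \<mu> 1] by simp
  then show ?thesis
    using nn_integral_eq_integral[of lborel "\<lambda>x. normal_density \<mu> \<sigma> x * (x - \<mu>)\<^sup>2"]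
    by (auto simp: has_bochner_integral_iff ennreal_mult'[symmetric])
qed

text \<open>Beyond C, half of the exponent t^2 / (2 * \<zeta>^2) is at least C^2 / (4 * \<zeta>^2),
  and the other half is the exponent of a normal density with variance 2 * \<zeta>^2. The factor
  sqrt 2 is the ratio of the normalising constants.\<close>

lemma normal_tail:
  assumes \<zeta>: "0 < \<zeta>" and C: "0 \<le> C"
  shows "(\<integral>\<^sup>+t. ennreal (normal_density 0 \<zeta> t) * indicator {t. C < \<bar>t\<bar>} t \<partial>lborel)
    \<le> ennreal (sqrt 2 * exp (- C\<^sup>2 / (4 * \<zeta>\<^sup>2)))"
proof -
  have "ennreal (normal_density 0 \<zeta> t) * indicator {t. C < \<bar>t\<bar>} t
      \<le> ennreal (sqrt 2 * exp (- C\<^sup>2 / (4 * \<zeta>\<^sup>2))) * ennreal (normal_density 0 (sqrt 2 * \<zeta>) t)" for t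
  proof (cases "C < \<bar>t\<bar>")
    case True
    then have "C\<^sup>2 \<le> t\<^sup>2"
      using C by (simp add: abs_le_square_iff[symmetric])
    then have "- t\<^sup>2 / (2 * \<zeta>\<^sup>2) \<le> - C\<^sup>2 / (4 * \<zeta>\<^sup>2) + - t\<^sup>2 / (4 * \<zeta>\<^sup>2)"
      using \<zeta> by (simp add: field_simps)
    then have "exp (- t\<^sup>2 / (2 * \<zeta>\<^sup>2)) \<le> exp (- C\<^sup>2 / (4 * \<zeta>\<^sup>2)) * exp (- t\<^sup>2 / (4 * \<zeta>\<^sup>2))"
      by (simp add: exp_add[symmetric])
    moreover have "sqrt 2 * exp (- C\<^sup>2 / (4 * \<zeta>\<^sup>2)) * normal_density 0 (sqrt 2 * \<zeta>) t
        = exp (- C\<^sup>2 / (4 * \<zeta>\<^sup>2)) * exp (- t\<^sup>2 / (4 * \<zeta>\<^sup>2)) / sqrt (2 * pi * \<zeta>\<^sup>2)"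
      using \<zeta> by (simp add: normal_density_def real_sqrt_mult power_mult_distrib frac_eq_eq)
    ultimately have "normal_density 0 \<zeta> t \<le> sqrt 2 * exp (- C\<^sup>2 / (4 * \<zeta>\<^sup>2)) * normal_density 0 (sqrt 2 * \<zeta>) t"
      using \<zeta> by (simp add: normal_density_def divide_right_mono)
    then show ?thesis
      using True by (simp add: ennreal_mult'[symmetric] ennreal_leI)
  qed auto
  then have "(\<integral>\<^sup>+t. ennreal (normal_density 0 \<zeta> t) * indicator {t. C < \<bar>t\<bar>} t \<partial>lborel)
      \<le> (\<integral>\<^sup>+t. ennreal (sqrt 2 * exp (- C\<^sup>2 / (4 * \<zeta>\<^sup>2))) * ennreal (normal_density 0 (sqrt 2 * \<zeta>) t) \<partial>lborel)"
    by (intro nn_integral_mono)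
  also have "\<dots> = ennreal (sqrt 2 * exp (- C\<^sup>2 / (4 * \<zeta>\<^sup>2)))"
    using \<zeta> by (subst nn_integral_cmult) (auto simp: nn_integral_normal_density)
  finally show ?thesis .
qed

text \<open>This gives prior, posterior and variational laws densities with respect to one base
  measure, as the density formula for the KL divergence requires.\<close>

lemma PiM_density_lborel:
  fixes f :: "'i \<Rightarrow> real \<Rightarrow> real"
  assumes fin: "finite I" and f: "\<And>i. i \<in> I \<Longrightarrow> f i \<in> borel_measurable borel"
    and nn: "\<And>i x. i \<in> I \<Longrightarrow> 0 \<le> f i x"
    and prob: "\<And>i. i \<in> I \<Longrightarrow> (\<integral>\<^sup>+x. ennreal (f i x) \<partial>lborel) = 1"
  shows "PiM I (\<lambda>i. density lborel (\<lambda>t. ennreal (f i t)))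
    = density (PiM I (\<lambda>_. lborel)) (\<lambda>\<theta>. ennreal (\<Prod>i\<in>I. f i (\<theta> i)))"
proof -
  \<comment> \<open>The factors are padded by \<open>lborel\<close> outside I, because
    \<open>product_sigma_finite\<close> asks for sigma-finiteness at every index.\<close>
  define M where "M i = (if i \<in> I then density lborel (\<lambda>t. ennreal (f i t)) else lborel)" for i
  have sf: "sigma_finite_measure (M i)" for i
  proof (cases "i \<in> I")
    case True
    then have "prob_space (M i)"
      using f[OF True] prob[OF True]
      by (auto simp: M_def emeasure_density intro!: prob_spaceI)
    then show ?thesis
      by (simp add: prob_space_imp_sigma_finite)
  qed (simp add: M_def sigma_finite_lborel)
  interpret P: product_sigma_finite M
    using sf by unfold_locales (auto simp: sigma_finite_measure_def)
  interpret L: product_sigma_finite "\<lambda>_::'i. lborel :: real measure"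
    by unfold_locales
  have "density (PiM I (\<lambda>_. lborel)) (\<lambda>\<theta>. ennreal (\<Prod>i\<in>I. f i (\<theta> i))) = PiM I M"
  proof (rule P.PiM_eqI[OF fin])
    show "sets (density (PiM I (\<lambda>_. lborel)) (\<lambda>\<theta>. ennreal (\<Prod>i\<in>I. f i (\<theta> i)))) = sets (PiM I M)"
      by (auto simp: M_def intro!: sets_PiM_cong)
    fix A assume A: "\<And>i. i \<in> I \<Longrightarrow> A i \<in> sets (M i)"
    then have A': "A i \<in> sets borel" if "i \<in> I" for i
      using that A[OF that] by (auto simp: M_def)
    have PA: "Pi\<^sub>E I A \<in> sets (PiM I (\<lambda>_. lborel))"
      using A' fin by (intro sets_PiM_I_finite) auto
    have meas: "(\<lambda>\<theta>. ennreal (\<Prod>i\<in>I. f i (\<theta> i))) \<in> borel_measurable (PiM I (\<lambda>_. lborel))"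
      using f by (intro measurable_compose[OF _ measurable_ennreal] borel_measurable_prod
        measurable_compose[OF measurable_component_singleton]) auto
    have "emeasure (density (PiM I (\<lambda>_. lborel)) (\<lambda>\<theta>. ennreal (\<Prod>i\<in>I. f i (\<theta> i)))) (Pi\<^sub>E I A)
        = (\<integral>\<^sup>+\<theta>. ennreal (\<Prod>i\<in>I. f i (\<theta> i)) * indicator (Pi\<^sub>E I A) \<theta> \<partial>PiM I (\<lambda>_. lborel))"
      by (rule emeasure_density[OF meas PA])
    also have "\<dots> = (\<integral>\<^sup>+\<theta>. (\<Prod>i\<in>I. ennreal (f i (\<theta> i)) * indicator (A i) (\<theta> i)) \<partial>PiM I (\<lambda>_. lborel))"
    proof (rule nn_integral_cong)
      fix \<theta> assume \<theta>: "\<theta> \<in> space (PiM I (\<lambda>_. lborel :: real measure))"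
      have "indicator (Pi\<^sub>E I A) \<theta> = (\<Prod>i\<in>I. indicator (A i) (\<theta> i) :: ennreal)"
      proof (cases "\<theta> \<in> Pi\<^sub>E I A")
        case False
        then obtain i where "i \<in> I" "\<theta> i \<notin> A i"
          using \<theta> by (auto simp: space_PiM PiE_def Pi_def)
        then show ?thesis
          using False fin by (intro trans[OF _ prod_zero[symmetric]]) (auto intro!: bexI[of _ i])
      qed (auto simp: PiE_def Pi_def)
      then show "ennreal (\<Prod>i\<in>I. f i (\<theta> i)) * indicator (Pi\<^sub>E I A) \<theta>
          = (\<Prod>i\<in>I. ennreal (f i (\<theta> i)) * indicator (A i) (\<theta> i))"
        using nn by (simp add: prod.distrib prod_ennreal)
    qed
    also have "\<dots> = (\<Prod>i\<in>I. \<integral>\<^sup>+x. ennreal (f i x) * indicator (A i) x \<partial>lborel)"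
      using A' f by (intro L.product_nn_integral_prod fin borel_measurable_times_ennreal) auto
    also have "\<dots> = (\<Prod>i\<in>I. emeasure (M i) (A i))"
      using A' f by (intro prod.cong) (auto simp: M_def emeasure_density)
    finally show "emeasure (density (PiM I (\<lambda>_. lborel)) (\<lambda>\<theta>. ennreal (\<Prod>i\<in>I. f i (\<theta> i)))) (Pi\<^sub>E I A)
        = (\<Prod>i\<in>I. emeasure (M i) (A i))" .
  qed
  also have "PiM I M = PiM I (\<lambda>i. density lborel (\<lambda>t. ennreal (f i t)))"
    by (rule PiM_cong) (auto simp: M_def)
  finally show ?thesis ..
qed

text \<open>After squaring: 1 / (1 - u) \<le> 1 + 2 * u \<le> exp (2 * u). It bounds the factor by
  which a Gaussian integral grows when the quadratic of a bracket is shrunk.\<close>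

lemma sqrt_inverse_le_exp: "0 \<le> u \<Longrightarrow> u \<le> 1 / 2 \<Longrightarrow> sqrt (1 / (1 - u)) \<le> exp (u::real)"
proof -
  assume u: "0 \<le> u" "u \<le> 1 / 2"
  have "1 / (1 - u) \<le> 1 + 2 * u"
    using u by (simp add: field_simps) (simp add: power2_eq_square[symmetric] mult_left_le)
  also have "\<dots> \<le> exp (2 * u)"
    by (rule exp_ge_add_one_self)
  also have "\<dots> = (exp u)\<^sup>2"
    by (simp add: exp_double)
  finally show ?thesis
    by (rule real_le_lsqrt[rotated 1]) simp
qed

text \<open>The point s * u lies between 0 and u, where the chord of the convex exponential lies
  above its graph. It turns a bound on the affinity into one for the integrand raised to the power
  s.\<close>

lemma exp_mult_le_affine:
  fixes u s :: real
  assumes "0 \<le> s" "s \<le> 1"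
  shows "exp (s * u) \<le> s * exp u + (1 - s)"
  using convex_onD[OF exp_convex, of s 0 u] assms by simp

lemma normal_density_mult_exp:
  assumes "0 < \<sigma>"
  shows "normal_density \<mu> \<sigma> y * exp (((y - \<mu>)\<^sup>2 - (y - m)\<^sup>2) / (2 * \<sigma>\<^sup>2)) = normal_density m \<sigma> y"
  by (simp add: normal_density_def diff_divide_distrib exp_add[symmetric])

section \<open>Regression data and Hellinger affinity\<close>

text \<open>The normalising constants of the two Gaussians cancel because both have the same
  \<sigma>.\<close>

definition log_ratio ::
    "nat \<Rightarrow> nat \<Rightarrow> ((nat \<Rightarrow> real) \<Rightarrow> real) \<Rightarrow> real \<Rightarrow> nat \<Rightarrow> (nat \<Rightarrow> real) \<Rightarrow> (nat \<Rightarrow> (nat \<Rightarrow> real) \<times> real) \<Rightarrow> real" where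
  "log_ratio p k f0 \<sigma> n \<theta> D = (\<Sum>i<n. ((snd (D i) - f0 (fst (D i)))\<^sup>2
      - (snd (D i) - nnet p k \<theta> (fst (D i)))\<^sup>2) / (2 * \<sigma>\<^sup>2))"

definition unit_cube :: "nat \<Rightarrow> (nat \<Rightarrow> real) set" where
  "unit_cube p = {x. \<forall>h<p. 0 \<le> x h \<and> x h \<le> 1}"

lemma sets_covariate_measure [measurable_cong]:
  "sets (covariate_measure p) = sets (PiM {..<p} (\<lambda>_. borel))"
  unfolding covariate_measure_def by (intro sets_PiM_cong) auto

lemma prob_space_uniform_unit: "prob_space (uniform_measure lborel {0..1::real})"
  by (rule prob_space_uniform_measure) auto

lemma prob_space_covariate_measure: "prob_space (covariate_measure p)"
  unfolding covariate_measure_def by (intro prob_space_PiM prob_space_uniform_unit)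

lemma AE_unit_cube: "AE x in covariate_measure p. x \<in> unit_cube p"
proof -
  have "AE t in uniform_measure lborel {0..1::real}. 0 \<le> t \<and> t \<le> 1"
    by (rule AE_uniform_measureI) auto
  then have "AE x in covariate_measure p. 0 \<le> x h \<and> x h \<le> 1" if "h < p" for h
    unfolding covariate_measure_def using that prob_space_uniform_unit
    by (intro AE_PiM_component) auto
  then show ?thesis
    unfolding unit_cube_def mem_Collect_eq by (subst AE_all_countable) auto
qed

lemma sqrt_normal_density:
  assumes "0 < \<sigma>"
  shows "sqrt (normal_density m \<sigma> y) = sqrt (1 / sqrt (2 * pi * \<sigma>\<^sup>2)) * exp (- (1 / (4 * \<sigma>\<^sup>2) * (y - m)\<^sup>2))"
proof -
  have "exp (- (y - m)\<^sup>2 / (2 * \<sigma>\<^sup>2)) = (exp (- (1 / (4 * \<sigma>\<^sup>2) * (y - m)\<^sup>2)))\<^sup>2"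
    by (simp add: exp_double[symmetric])
  then show ?thesis
    by (simp only: normal_density_def real_sqrt_mult real_sqrt_abs abs_exp_cancel)
qed

locale nnet_regression =
  fixes p :: nat and f0 :: "(nat \<Rightarrow> real) \<Rightarrow> real" and \<sigma> :: real
  assumes f0 [measurable]: "f0 \<in> borel_measurable (covariate_measure p)"
    and \<sigma>: "0 < \<sigma>"
begin

sublocale cov: prob_space "covariate_measure p"
  by (rule prob_space_covariate_measure)

abbreviation obs :: "((nat \<Rightarrow> real) \<times> real) measure" where
  "obs \<equiv> true_obs_measure p f0 \<sigma>"

abbreviation data :: "nat \<Rightarrow> (nat \<Rightarrow> (nat \<Rightarrow> real) \<times> real) measure" where
  "data n \<equiv> true_data_measure p f0 \<sigma> n"

lemma nnet_covariate_measurable [measurable]: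
  "nnet p k \<theta> \<in> borel_measurable (covariate_measure p)"
  by (rule nnet_measurable[where \<theta> = "\<lambda>_. \<theta>" and x = "\<lambda>x. x"]) (auto simp: covariate_measure_def)

lemma normal_density_measurable_pair [measurable]:
  "(\<lambda>(x, y). normal_density (f x) \<sigma> y) \<in> borel_measurable (covariate_measure p \<Otimes>\<^sub>M lborel)"
  if [measurable]: "f \<in> borel_measurable (covariate_measure p)" for f
  unfolding normal_density_def by measurable

lemma sets_obs [measurable_cong, simp]: "sets obs = sets (covariate_measure p \<Otimes>\<^sub>M lborel)"
  by (simp add: true_obs_measure_def)

lemma nn_integral_obs:
  assumes F [measurable]: "F \<in> borel_measurable (covariate_measure p \<Otimes>\<^sub>M lborel)"
  shows "(\<integral>\<^sup>+z. F z \<partial>obs) =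
    (\<integral>\<^sup>+x. (\<integral>\<^sup>+y. ennreal (normal_density (f0 x) \<sigma> y) * F (x, y) \<partial>lborel) \<partial>covariate_measure p)"
  unfolding true_obs_measure_def
  by (subst nn_integral_density) (auto simp: lborel.nn_integral_fst[symmetric] split_beta')

sublocale obs: prob_space obs
proof
  have "emeasure obs (space obs) = (\<integral>\<^sup>+z. 1 \<partial>obs)"
    by simp
  also have "\<dots> = (\<integral>\<^sup>+x. 1 \<partial>covariate_measure p)"
    by (subst nn_integral_obs) (auto simp: nn_integral_normal_density \<sigma>)
  finally show "emeasure obs (space obs) = 1"
    by (simp add: cov.emeasure_space_1)
qed

lemma AE_obs_unit_cube: "AE z in obs. fst z \<in> unit_cube p"
proof -
  \<comment> \<open>Measurable sets of the product consist of extensional functions only, so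
    \<open>unit_cube p\<close> has to be cut down to the space first.\<close>
  have [measurable]: "unit_cube p \<inter> space (covariate_measure p) \<in> sets (covariate_measure p)"
  proof -
    have "{x \<in> space (covariate_measure p). \<forall>h\<in>{..<p}. 0 \<le> x h \<and> x h \<le> 1} \<in> sets (covariate_measure p)"
      unfolding covariate_measure_def by measurable
    also have "{x \<in> space (covariate_measure p). \<forall>h\<in>{..<p}. 0 \<le> x h \<and> x h \<le> 1} = unit_cube p \<inter> space (covariate_measure p)"
      by (auto simp: unit_cube_def)
    finally show ?thesis .
  qed
  let ?N = "space (covariate_measure p) - unit_cube p \<inter> space (covariate_measure p)"
  have "(\<integral>\<^sup>+z. indicator ?N (fst z) \<partial>obs) = (\<integral>\<^sup>+x. indicator ?N x \<partial>covariate_measure p)"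
    by (subst nn_integral_obs) (auto simp: nn_integral_multc nn_integral_normal_density \<sigma>)
  also have "\<dots> = (\<integral>\<^sup>+x. 0 \<partial>covariate_measure p)"
    by (rule nn_integral_cong_AE, rule AE_mp[OF AE_unit_cube[of p]]) (auto simp: indicator_def)
  finally have "(\<integral>\<^sup>+z. indicator ?N (fst z) \<partial>obs) = 0"
    by simp
  then have "AE z in obs. indicator ?N (fst z) = (0::ennreal)"
    by (subst (asm) nn_integral_0_iff_AE) auto
  moreover have "fst z \<in> space (covariate_measure p)" if "z \<in> space obs" for z
    using that by (auto simp: true_obs_measure_def space_pair_measure)
  then have "AE z in obs. indicator ?N (fst z) = (0::ennreal) \<longrightarrow> fst z \<in> unit_cube p"
    by (auto simp: indicator_def)
  ultimately show ?thesis
    by (rule AE_mp)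
qed

lemma prob_space_data: "prob_space (data n)"
  unfolding true_data_measure_def by (intro prob_space_PiM obs.prob_space_axioms)

lemma nn_integral_data_prod:
  assumes F [measurable]: "F \<in> borel_measurable obs"
  shows "(\<integral>\<^sup>+D. (\<Prod>i<n. F (D i)) \<partial>data n) = (\<integral>\<^sup>+z. F z \<partial>obs) ^ n"
proof -
  interpret product_sigma_finite "\<lambda>_::nat. obs"
    by unfold_locales
  show ?thesis
    unfolding true_data_measure_def by (subst product_nn_integral_prod) auto
qed

lemma nn_integral_data_component:
  assumes F: "F \<in> borel_measurable obs" and i: "i < n"
  shows "(\<integral>\<^sup>+D. F (D i) \<partial>data n) = (\<integral>\<^sup>+z. F z \<partial>obs)"
proof -
  have "distr (data n) obs (\<lambda>D. D i) = obs"
    unfolding true_data_measure_def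
    using distr_PiM_component[of "{..<n}" "\<lambda>_. obs" i] i obs.prob_space_axioms by simp
  then have "(\<integral>\<^sup>+z. F z \<partial>obs) = (\<integral>\<^sup>+z. F z \<partial>distr (data n) obs (\<lambda>D. D i))"
    by simp
  also have "\<dots> = (\<integral>\<^sup>+D. F (D i) \<partial>data n)"
    using F i by (intro nn_integral_distr) (auto simp: true_data_measure_def)
  finally show ?thesis ..
qed

lemma nn_integral_data_sum:
  assumes F: "F \<in> borel_measurable obs"
  shows "(\<integral>\<^sup>+D. (\<Sum>i<n. F (D i)) \<partial>data n) = of_nat n * (\<integral>\<^sup>+z. F z \<partial>obs)"
proof -
  have "(\<integral>\<^sup>+D. (\<Sum>i<n. F (D i)) \<partial>data n) = (\<Sum>i<n. \<integral>\<^sup>+D. F (D i) \<partial>data n)"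
    using F by (intro nn_integral_sum) (auto simp: true_data_measure_def
      intro: measurable_compose[OF measurable_component_singleton])
  then show ?thesis
    by (simp add: nn_integral_data_component[OF F])
qed

lemma AE_data_unit_cube: "AE D in data n. \<forall>i<n. fst (D i) \<in> unit_cube p"
proof -
  have "AE D in data n. fst (D i) \<in> unit_cube p" if "i < n" for i
    unfolding true_data_measure_def using that obs.prob_space_axioms AE_obs_unit_cube
    by (intro AE_PiM_component) auto
  then show ?thesis
    by (subst AE_all_countable) auto
qed

section \<open>Likelihood ratios and the Gaussian affinity\<close>

lemma exp_log_ratio:
  "ennreal (exp (log_ratio p k f0 \<sigma> n \<theta> D)) =
    (\<Prod>i<n. ennreal (exp (((snd (D i) - f0 (fst (D i)))\<^sup>2
      - (snd (D i) - nnet p k \<theta> (fst (D i)))\<^sup>2) / (2 * \<sigma>\<^sup>2))))"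
  by (simp add: log_ratio_def exp_sum prod_ennreal)

text \<open>The true density times one factor of the ratio is the density of the network model,
  which integrates to one. This holds for good and bad \<theta> alike, so it controls the averaged
  evidence but cannot detect distance from the truth.\<close>

lemma nn_integral_exp_log_ratio:
  "(\<integral>\<^sup>+D. ennreal (exp (log_ratio p k f0 \<sigma> n \<theta> D)) \<partial>data n) = 1"
proof -
  let ?r = "\<lambda>z. ennreal (exp (((snd z - f0 (fst z))\<^sup>2 - (snd z - nnet p k \<theta> (fst z))\<^sup>2) / (2 * \<sigma>\<^sup>2)))"
  have r: "ennreal (normal_density (f0 x) \<sigma> y) * ?r (x, y) = ennreal (normal_density (nnet p k \<theta> x) \<sigma> y)" for x y
    by (subst normal_density_mult_exp[OF \<sigma>, of "f0 x" y "nnet p k \<theta> x", symmetric]) (simp add: ennreal_mult')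
  have "(\<integral>\<^sup>+z. ?r z \<partial>obs)
      = (\<integral>\<^sup>+x. (\<integral>\<^sup>+y. ennreal (normal_density (nnet p k \<theta> x) \<sigma> y) \<partial>lborel) \<partial>covariate_measure p)"
    by (subst nn_integral_obs) (auto simp: r[simplified])
  also have "\<dots> = 1"
    by (simp add: nn_integral_normal_density \<sigma> cov.emeasure_space_1)
  finally show ?thesis
    unfolding exp_log_ratio by (subst nn_integral_data_prod) auto
qed

text \<open>Pointwise, (sqrt l - sqrt l0)^2 + 2 * sqrt (l * l0) = l + l0, and the right side has
  total mass 2. The cross term is Gaussian in y and integrates to the displayed exponential. The
  additive form avoids subtraction in \<open>ennreal\<close>.\<close>

lemma hellinger_affinity:
  "ennreal (hellinger p k f0 \<sigma> \<theta>)
    + 2 * (\<integral>\<^sup>+x. ennreal (exp (- (nnet p k \<theta> x - f0 x)\<^sup>2 / (8 * \<sigma>\<^sup>2))) \<partial>covariate_measure p) = 2"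
proof -
  let ?P = "covariate_measure p \<Otimes>\<^sub>M lborel"
  let ?l = "\<lambda>x y. normal_density (nnet p k \<theta> x) \<sigma> y" and ?g = "\<lambda>x y. normal_density (f0 x) \<sigma> y"
  define H where "H = (\<integral>\<^sup>+ (x, y). ennreal ((sqrt (?l x y) - sqrt (?g x y))\<^sup>2) \<partial>?P)"
  define R where "R = (\<integral>\<^sup>+x. ennreal (exp (- (nnet p k \<theta> x - f0 x)\<^sup>2 / (8 * \<sigma>\<^sup>2))) \<partial>covariate_measure p)"
  have inner: "(\<integral>\<^sup>+y. ennreal (sqrt (?l x y) * sqrt (?g x y)) \<partial>lborel)
      = ennreal (exp (- (nnet p k \<theta> x - f0 x)\<^sup>2 / (8 * \<sigma>\<^sup>2)))" for x
  proof -
    let ?A = "1 / (4 * \<sigma>\<^sup>2)"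
    have "sqrt (?l x y) * sqrt (?g x y)
        = 1 / sqrt (2 * pi * \<sigma>\<^sup>2) * exp (- (?A * (y - nnet p k \<theta> x)\<^sup>2) - ?A * (y - f0 x)\<^sup>2)" for y
    proof -
      have "(sqrt c * exp u) * (sqrt c * exp v) = c * exp (u + v)" if "0 \<le> c" for c u v :: real
        using that by (simp add: exp_add mult_ac)
      from this[of "1 / sqrt (2 * pi * \<sigma>\<^sup>2)"] show ?thesis
        unfolding sqrt_normal_density[OF \<sigma>] by simp
    qed
    then have "(\<integral>\<^sup>+y. ennreal (sqrt (?l x y) * sqrt (?g x y)) \<partial>lborel)
        = ennreal (1 / sqrt (2 * pi * \<sigma>\<^sup>2)) *
          (\<integral>\<^sup>+y. ennreal (exp (- (?A * (y - nnet p k \<theta> x)\<^sup>2) - ?A * (y - f0 x)\<^sup>2)) \<partial>lborel)"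
      by (subst nn_integral_cmult[symmetric]) (auto simp: ennreal_mult'[symmetric])
    also have "\<dots> = ennreal (1 / sqrt (2 * pi * \<sigma>\<^sup>2)) *
        ennreal (sqrt (pi / (?A + ?A)) * exp (- (?A * ?A / (?A + ?A) * (nnet p k \<theta> x - f0 x)\<^sup>2)))"
      using \<sigma> by (subst nn_integral_exp_neg_two_squares) auto
    also have "sqrt (pi / (?A + ?A)) = sqrt (2 * pi * \<sigma>\<^sup>2)"
      using \<sigma> by (simp add: field_simps)
    also have "?A * ?A / (?A + ?A) * (nnet p k \<theta> x - f0 x)\<^sup>2 = (nnet p k \<theta> x - f0 x)\<^sup>2 / (8 * \<sigma>\<^sup>2)"
      using \<sigma> by (simp add: field_simps)
    finally show ?thesis
      using \<sigma> by (simp add: ennreal_mult'[symmetric])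
  qed
  have "H + 2 * R = H + 2 * (\<integral>\<^sup>+ (x, y). ennreal (sqrt (?l x y) * sqrt (?g x y)) \<partial>?P)"
    unfolding R_def by (subst lborel.nn_integral_fst[symmetric]) (auto simp: inner)
  also have "\<dots> = (\<integral>\<^sup>+ (x, y). ennreal ((sqrt (?l x y) - sqrt (?g x y))\<^sup>2) + 2 * ennreal (sqrt (?l x y) * sqrt (?g x y)) \<partial>?P)"
    unfolding H_def split_beta' by (subst nn_integral_add) (auto simp: nn_integral_cmult)
  also have "\<dots> = (\<integral>\<^sup>+ (x, y). ennreal (?l x y) + ennreal (?g x y) \<partial>?P)"
  proof (intro nn_integral_cong, clarsimp simp del: ennreal_plus)
    fix x y
    have "(sqrt (?l x y) - sqrt (?g x y))\<^sup>2 + 2 * (sqrt (?l x y) * sqrt (?g x y)) = ?l x y + ?g x y"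
      by (simp add: power2_diff)
    then show "ennreal ((sqrt (?l x y) - sqrt (?g x y))\<^sup>2) + 2 * ennreal (sqrt (?l x y) * sqrt (?g x y))
        = ennreal (?l x y) + ennreal (?g x y)"
      by (simp add: ennreal_plus[symmetric] ennreal_mult'[symmetric] flip: ennreal_numeral del: ennreal_plus)
  qed
  also have "\<dots> = 2"
    unfolding split_beta'
    by (subst nn_integral_add)
      (auto simp: lborel.nn_integral_fst[symmetric] nn_integral_normal_density \<sigma> cov.emeasure_space_1)
  finally have *: "H + 2 * R = 2" .
  \<comment> \<open>Finiteness matters because \<open>hellinger\<close> passes through
    \<open>enn2real\<close>, which sends infinity to 0.\<close>
  then have "H < \<top>"
    by (metis ennreal_add_eq_top ennreal_numeral ennreal_neq_top top.not_eq_extremum)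
  then have "ennreal (hellinger p k f0 \<sigma> \<theta>) = H"
    by (simp add: hellinger_def H_def[symmetric] ennreal_enn2real_if)
  with * show ?thesis
    by (simp add: R_def)
qed

end

section \<open>Uniform likelihood bounds away from the truth\<close>

text \<open>The centres must lie in S, so that they inherit both the box and the distance from the
  truth; hence each cell is represented by one of its own points, not by a grid point. Per
  coordinate the floors range over 2 * \<lceil>C / h\<rceil> + 1 integers, which is at most 2 * C /
  h + 3.\<close>

lemma cube_net:
  fixes S :: "(nat \<Rightarrow> real) set"
  assumes S: "\<And>\<theta> i. \<theta> \<in> S \<Longrightarrow> i < K \<Longrightarrow> \<bar>\<theta> i\<bar> \<le> C" and h: "0 < h" and C: "0 \<le> C"
  obtains T where "T \<subseteq> S" "finite T" "real (card T) \<le> (2 * C / h + 3) ^ K"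
    "\<And>\<theta>. \<theta> \<in> S \<Longrightarrow> \<exists>\<theta>'\<in>T. \<forall>i<K. \<bar>\<theta> i - \<theta>' i\<bar> \<le> h"
proof
  define c where "c \<theta> = restrict (\<lambda>i. \<lfloor>\<theta> i / h\<rfloor>) {..<K}" for \<theta> :: "nat \<Rightarrow> real"
  define P where "P = PiE {..<K} (\<lambda>_. {- \<lceil>C / h\<rceil>..\<lceil>C / h\<rceil>})"
  \<comment> \<open>One representative for each nonempty cell, a cell being a level set of the
    coordinatewise floor \<open>c\<close>.\<close>
  define T where "T = inv_into S c ` c ` S"
  have "finite P"
    unfolding P_def by (intro finite_PiE) auto
  have "c \<theta> \<in> P" if "\<theta> \<in> S" for \<theta>
  proof -
    have "- \<lceil>C / h\<rceil> \<le> \<lfloor>\<theta> i / h\<rfloor>" "\<lfloor>\<theta> i / h\<rfloor> \<le> \<lceil>C / h\<rceil>" if "i < K" for i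
    proof -
      have "- (C / h) \<le> \<theta> i / h" "\<theta> i / h \<le> C / h"
        using S[OF \<open>\<theta> \<in> S\<close> that] h by (auto simp: abs_le_iff field_simps)
      then show "- \<lceil>C / h\<rceil> \<le> \<lfloor>\<theta> i / h\<rfloor>" "\<lfloor>\<theta> i / h\<rfloor> \<le> \<lceil>C / h\<rceil>"
        by linarith+
    qed
    then show ?thesis
      by (auto simp: c_def P_def)
  qed
  then have sub: "c ` S \<subseteq> P"
    by auto
  have fin: "finite (c ` S)"
    using sub \<open>finite P\<close> by (rule finite_subset)
  show "T \<subseteq> S"
    by (auto simp: T_def inv_into_into)
  show "finite T"
    using fin by (simp add: T_def)
  have "card T \<le> card P"
    using card_image_le[OF fin] card_mono[OF \<open>finite P\<close> sub] unfolding T_def by (rule order_trans)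
  also have "card P = nat (2 * \<lceil>C / h\<rceil> + 1) ^ K"
    by (simp add: P_def card_PiE)
  finally have "real (card T) \<le> real (nat (2 * \<lceil>C / h\<rceil> + 1)) ^ K"
    by (metis of_nat_le_iff of_nat_power)
  also have "\<dots> \<le> (2 * C / h + 3) ^ K"
  proof (rule power_mono)
    have "0 \<le> C / h"
      using C h by simp
    moreover have "2 * (C / h) = 2 * C / h"
      by simp
    ultimately show "real (nat (2 * \<lceil>C / h\<rceil> + 1)) \<le> 2 * C / h + 3"
      by linarith
  qed simp
  finally show "real (card T) \<le> (2 * C / h + 3) ^ K" .
  fix \<theta> assume \<theta>: "\<theta> \<in> S"
  define \<theta>' where "\<theta>' = inv_into S c (c \<theta>)"
  have eq: "c \<theta>' = c \<theta>"
    using \<theta> by (simp add: \<theta>'_def f_inv_into_f)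
  have "\<bar>\<theta> i - \<theta>' i\<bar> \<le> h" if "i < K" for i
  proof -
    have "\<lfloor>\<theta> i / h\<rfloor> = \<lfloor>\<theta>' i / h\<rfloor>"
      using fun_cong[OF eq, of i] that by (simp add: c_def)
    then have "\<bar>\<theta> i / h - \<theta>' i / h\<bar> \<le> 1"
      by linarith
    then show ?thesis
      using h by (simp add: diff_divide_distrib[symmetric] abs_divide)
  qed
  moreover have "\<theta>' \<in> T"
    using \<theta> by (auto simp: \<theta>'_def T_def)
  ultimately show "\<exists>\<theta>'\<in>T. \<forall>i<K. \<bar>\<theta> i - \<theta>' i\<bar> \<le> h"
    by blast
qed

text \<open>With u = y - m and v = m - m', this replaces a network value m by the nearby centre m'
  at every y at once; plain expansion would leave a term linear in y. The slack is the square
  (\<tau> * u - (1 - \<tau>) * v)^2 / \<tau> plus v^2.\<close>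

lemma square_add_le_weighted:
  fixes u v \<tau> :: real
  assumes "0 < \<tau>" "\<tau> < 1"
  shows "(1 - \<tau>) * (u + v)\<^sup>2 \<le> u\<^sup>2 + v\<^sup>2 / \<tau>"
proof -
  have "0 \<le> (\<tau> * u - (1 - \<tau>) * v)\<^sup>2 / \<tau>"
    using assms by simp
  also have "\<dots> = u\<^sup>2 + v\<^sup>2 / \<tau> - (1 - \<tau>) * (u + v)\<^sup>2 - v\<^sup>2"
    using assms by (simp add: power2_eq_square field_simps)
  also have "\<dots> \<le> u\<^sup>2 + v\<^sup>2 / \<tau> - (1 - \<tau>) * (u + v)\<^sup>2"
    by simp
  finally show ?thesis
    by simp
qed

context nnet_regression
begin

text \<open>
  The exponential of \<open>bracket\<close> dominates \<open>sqrt (l / l0)\<close> for every network within \<open>\<eta>\<close> of the given one.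
  Shrinking the quadratic by \<open>1 - \<tau>\<close> absorbs the cross term, so its integral stays Gaussian.
\<close>
definition bracket :: "real \<Rightarrow> real \<Rightarrow> nat \<Rightarrow> (nat \<Rightarrow> real) \<Rightarrow> (nat \<Rightarrow> real) \<times> real \<Rightarrow> real" where
  "bracket \<eta> \<tau> k \<theta> z = \<eta>\<^sup>2 / (4 * \<sigma>\<^sup>2 * \<tau>)
    - (1 - \<tau>) / (4 * \<sigma>\<^sup>2) * (snd z - nnet p k \<theta> (fst z))\<^sup>2 + 1 / (4 * \<sigma>\<^sup>2) * (snd z - f0 (fst z))\<^sup>2"

lemma bracket_measurable [measurable]:
  "bracket \<eta> \<tau> k \<theta> \<in> borel_measurable (covariate_measure p \<Otimes>\<^sub>M lborel)"
  unfolding bracket_def[abs_def] by measurable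

text \<open>A bracket bounds half a log-ratio term, whence the factor 2. The estimate is pointwise
  in the data, so one centre serves its whole cell.\<close>

lemma log_ratio_le_bracket:
  assumes \<tau>: "0 < \<tau>" "\<tau> < 1"
    and near: "\<And>i. i < n \<Longrightarrow> \<bar>nnet p k \<theta> (fst (D i)) - nnet p k \<theta>' (fst (D i))\<bar> \<le> \<eta>"
  shows "log_ratio p k f0 \<sigma> n \<theta> D \<le> 2 * (\<Sum>i<n. bracket \<eta> \<tau> k \<theta>' (D i))"
  unfolding log_ratio_def sum_distrib_left
proof (rule sum_mono)
  fix i assume "i \<in> {..<n}"
  define y m m' m0 where "y = snd (D i)" and "m = nnet p k \<theta> (fst (D i))"
    and "m' = nnet p k \<theta>' (fst (D i))" and "m0 = f0 (fst (D i))"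
  have "(m - m')\<^sup>2 \<le> \<eta>\<^sup>2"
    using near[of i] \<open>i \<in> {..<n}\<close> by (simp add: m_def m'_def abs_le_square_iff[symmetric])
  then have "(m - m')\<^sup>2 / \<tau> \<le> \<eta>\<^sup>2 / \<tau>"
    using \<tau> by (simp add: divide_right_mono)
  moreover have "(1 - \<tau>) * (y - m')\<^sup>2 \<le> (y - m)\<^sup>2 + (m - m')\<^sup>2 / \<tau>"
    using square_add_le_weighted[OF \<tau>, of "y - m" "m - m'"] by simp
  ultimately have "(y - m0)\<^sup>2 - (y - m)\<^sup>2 \<le> \<eta>\<^sup>2 / \<tau> - (1 - \<tau>) * (y - m')\<^sup>2 + (y - m0)\<^sup>2"
    by linarith
  then have "((y - m0)\<^sup>2 - (y - m)\<^sup>2) / (2 * \<sigma>\<^sup>2)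
      \<le> (\<eta>\<^sup>2 / \<tau> - (1 - \<tau>) * (y - m')\<^sup>2 + (y - m0)\<^sup>2) / (2 * \<sigma>\<^sup>2)"
    using \<sigma> by (intro divide_right_mono) auto
  also have "\<dots> = 2 * bracket \<eta> \<tau> k \<theta>' (D i)"
    using \<sigma> \<tau> by (simp add: bracket_def y_def m'_def m0_def field_simps)
  finally show "((snd (D i) - f0 (fst (D i)))\<^sup>2 - (snd (D i) - nnet p k \<theta> (fst (D i)))\<^sup>2) / (2 * \<sigma>\<^sup>2)
      \<le> 2 * bracket \<eta> \<tau> k \<theta>' (D i)"
    by (simp add: y_def m_def m0_def)
qed

text \<open>The three terms of the exponent are the cost of the cell width, the cost of the lost
  curvature in the normalising constant, and the gain from separation. The affinity r is at most 1 -
  \<epsilon> / 2; the shrunken quadratic raises its integrand to a power s between 1/2 and 1, and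
  convexity gives the mean 1 - s * (1 - r) \<le> 1 - \<epsilon> / 4.\<close>

lemma nn_integral_bracket:
  assumes \<tau>: "0 < \<tau>" "\<tau> \<le> 1 / 2" and far: "\<epsilon> \<le> hellinger p k f0 \<sigma> \<theta>"
  shows "(\<integral>\<^sup>+z. ennreal (exp (bracket \<eta> \<tau> k \<theta> z)) \<partial>obs)
    \<le> ennreal (exp (\<eta>\<^sup>2 / (4 * \<sigma>\<^sup>2 * \<tau>) + \<tau> / 2 - \<epsilon> / 4))"
proof -
  define \<kappa> where "\<kappa> = \<eta>\<^sup>2 / (4 * \<sigma>\<^sup>2 * \<tau>)"
  define A B where "A = (1 - \<tau>) / (4 * \<sigma>\<^sup>2)" and "B = 1 / (4 * \<sigma>\<^sup>2)"
  define c where "c = 1 / sqrt (2 * pi * \<sigma>\<^sup>2) * exp \<kappa>"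
  \<comment> \<open>Completing the square with weights A and B multiplies the squared difference of
    the regressions by A * B / (A + B) = s / (8 * \<sigma>^2), so s compares this with the
    coefficient in the affinity.\<close>
  define s where "s = 2 * (1 - \<tau>) / (2 - \<tau>)"
  define \<Delta> where "\<Delta> x = - (nnet p k \<theta> x - f0 x)\<^sup>2 / (8 * \<sigma>\<^sup>2)" for x
  have AB: "0 < A" "0 < B" "A + B = (2 - \<tau>) / (4 * \<sigma>\<^sup>2)"
    using \<tau> \<sigma> by (auto simp: A_def B_def simp flip: add_divide_distrib)
  have s: "1 / 2 \<le> s" "s \<le> 1"
    using \<tau> by (auto simp: s_def field_simps)
  have c: "0 \<le> c"
    by (simp add: c_def)
  have [measurable]: "\<Delta> \<in> borel_measurable (covariate_measure p)"
    unfolding \<Delta>_def[abs_def] by measurable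
  have dens: "ennreal (normal_density (f0 x) \<sigma> y) * ennreal (exp (bracket \<eta> \<tau> k \<theta> (x, y)))
      = ennreal c * ennreal (exp (- (A * (y - nnet p k \<theta> x)\<^sup>2) - B * (y - f0 x)\<^sup>2))" for x y
  proof -
    have "normal_density (f0 x) \<sigma> y * exp (bracket \<eta> \<tau> k \<theta> (x, y)) =
        1 / sqrt (2 * pi * \<sigma>\<^sup>2) * exp (- (y - f0 x)\<^sup>2 / (2 * \<sigma>\<^sup>2) + bracket \<eta> \<tau> k \<theta> (x, y))"
      by (simp add: normal_density_def mult_exp_exp)
    also have "- (y - f0 x)\<^sup>2 / (2 * \<sigma>\<^sup>2) + bracket \<eta> \<tau> k \<theta> (x, y)
        = \<kappa> + (- (A * (y - nnet p k \<theta> x)\<^sup>2) - B * (y - f0 x)\<^sup>2)"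
      by (simp add: bracket_def \<kappa>_def A_def B_def)
    finally show ?thesis
      using c by (simp add: c_def exp_add ennreal_mult'[symmetric] mult_ac)
  qed
  have const: "c * sqrt (pi / (A + B)) \<le> exp (\<kappa> + \<tau> / 2)"
  proof -
    have "1 / sqrt (2 * pi * \<sigma>\<^sup>2) * sqrt (pi / (A + B)) = sqrt (1 / (1 - \<tau> / 2))"
      using \<tau> \<sigma> by (simp add: AB(3) real_sqrt_divide[symmetric] real_sqrt_mult[symmetric] field_simps del: real_sqrt_mult)
    also have "\<dots> \<le> exp (\<tau> / 2)"
      using \<tau> by (intro sqrt_inverse_le_exp) auto
    finally have "exp \<kappa> * (1 / sqrt (2 * pi * \<sigma>\<^sup>2) * sqrt (pi / (A + B))) \<le> exp \<kappa> * exp (\<tau> / 2)"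
      by (rule mult_left_mono) simp
    then show ?thesis
      by (simp add: c_def mult_exp_exp mult_ac)
  qed
  have expo: "- (A * B / (A + B) * (nnet p k \<theta> x - f0 x)\<^sup>2) = s * \<Delta> x" for x
  proof -
    have "A * B / (A + B) = s / (8 * \<sigma>\<^sup>2)"
      unfolding AB(3) using \<tau> \<sigma> by (simp add: A_def B_def s_def field_simps)
    then show ?thesis
      by (simp add: \<Delta>_def)
  qed
  define R where "R = (\<integral>\<^sup>+x. ennreal (exp (\<Delta> x)) \<partial>covariate_measure p)"
  have R: "ennreal (hellinger p k f0 \<sigma> \<theta>) + 2 * R = 2"
    unfolding R_def \<Delta>_def by (rule hellinger_affinity)
  then have "R \<noteq> \<top>"
    by (auto simp: ennreal_mult_top)
  then obtain r where r: "0 \<le> r" "R = ennreal r"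
    by (cases R) auto
  have "0 \<le> hellinger p k f0 \<sigma> \<theta>"
    by (simp add: hellinger_def)
  with R r have "ennreal (hellinger p k f0 \<sigma> \<theta> + 2 * r) = ennreal 2"
    by (simp add: ennreal_mult')
  then have "hellinger p k f0 \<sigma> \<theta> + 2 * r = 2"
    using r \<open>0 \<le> hellinger p k f0 \<sigma> \<theta>\<close> by (subst (asm) ennreal_inj) auto
  with far have r2: "r \<le> 1 - \<epsilon> / 2"
    by linarith
  have "(\<integral>\<^sup>+x. ennreal (exp (s * \<Delta> x)) \<partial>covariate_measure p)
      \<le> (\<integral>\<^sup>+x. ennreal s * ennreal (exp (\<Delta> x)) + ennreal (1 - s) \<partial>covariate_measure p)"
    using s exp_mult_le_affine[of s]
    by (intro nn_integral_mono) (auto simp: ennreal_mult'[symmetric] ennreal_plus[symmetric] simp del: ennreal_plus intro!: ennreal_leI)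
  also have "\<dots> = ennreal s * R + ennreal (1 - s)"
    by (subst nn_integral_add) (auto simp: nn_integral_cmult R_def cov.emeasure_space_1)
  also have "\<dots> = ennreal (s * r + (1 - s))"
    using s r by (simp add: ennreal_mult'[symmetric])
  also have "\<dots> \<le> ennreal (exp (- \<epsilon> / 4))"
  proof (rule ennreal_leI)
    have "s * r + (1 - s) = 1 - s * (1 - r)"
      by (simp add: algebra_simps)
    also have "\<dots> \<le> 1 - 1 / 2 * (\<epsilon> / 2)"
    proof -
      have "1 / 2 * (1 - r) \<le> s * (1 - r)"
        using s r \<open>hellinger p k f0 \<sigma> \<theta> + 2 * r = 2\<close> \<open>0 \<le> hellinger p k f0 \<sigma> \<theta>\<close>
        by (intro mult_right_mono) auto
      moreover have "1 / 2 * (\<epsilon> / 2) \<le> 1 / 2 * (1 - r)"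
        using r2 by simp
      ultimately show ?thesis
        by (intro diff_left_mono) (rule order_trans)
    qed
    also have "\<dots> \<le> exp (- \<epsilon> / 4)"
      using exp_ge_add_one_self[of "- \<epsilon> / 4"] by simp
    finally show "s * r + (1 - s) \<le> exp (- \<epsilon> / 4)" .
  qed
  finally have main: "(\<integral>\<^sup>+x. ennreal (exp (s * \<Delta> x)) \<partial>covariate_measure p) \<le> ennreal (exp (- \<epsilon> / 4))" .
  have "(\<integral>\<^sup>+z. ennreal (exp (bracket \<eta> \<tau> k \<theta> z)) \<partial>obs) =
      (\<integral>\<^sup>+x. ennreal c * ennreal (sqrt (pi / (A + B)) * exp (s * \<Delta> x)) \<partial>covariate_measure p)"
  proof (subst nn_integral_obs)
    have "(\<integral>\<^sup>+y. ennreal c * ennreal (exp (- (A * (y - nnet p k \<theta> x)\<^sup>2) - B * (y - f0 x)\<^sup>2)) \<partial>lborel)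
        = ennreal c * ennreal (sqrt (pi / (A + B)) * exp (s * \<Delta> x))" for x
      using nn_integral_exp_neg_two_squares[OF AB(1) less_imp_le[OF AB(2)], of "nnet p k \<theta> x" "f0 x"]
      by (subst nn_integral_cmult) (auto simp only: expo, measurable)
    then show "(\<integral>\<^sup>+x. \<integral>\<^sup>+y. ennreal (normal_density (f0 x) \<sigma> y) * ennreal (exp (bracket \<eta> \<tau> k \<theta> (x, y)))
          \<partial>lborel \<partial>covariate_measure p)
        = (\<integral>\<^sup>+x. ennreal c * ennreal (sqrt (pi / (A + B)) * exp (s * \<Delta> x)) \<partial>covariate_measure p)"
      by (simp only: dens)
  qed measurable
  also have "\<dots> = ennreal (c * sqrt (pi / (A + B))) * (\<integral>\<^sup>+x. ennreal (exp (s * \<Delta> x)) \<partial>covariate_measure p)"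
  proof -
    have "ennreal a * ennreal (b * e) = ennreal (a * b) * ennreal e" if "0 \<le> a" "0 \<le> b" for a b e :: real
      using that by (simp add: ennreal_mult' mult.assoc)
    moreover have "0 \<le> sqrt (pi / (A + B))"
      using AB(1,2) by simp
    ultimately have "ennreal c * ennreal (sqrt (pi / (A + B)) * e) = ennreal (c * sqrt (pi / (A + B))) * ennreal e" for e
      using c by blast
    then show ?thesis
      by (simp only:) (rule nn_integral_cmult, measurable)
  qed
  also have "\<dots> \<le> ennreal (exp (\<kappa> + \<tau> / 2)) * ennreal (exp (- \<epsilon> / 4))"
    by (intro mult_mono main ennreal_leI const) auto
  also have "\<dots> = ennreal (exp (\<kappa> + \<tau> / 2 - \<epsilon> / 4))"
    by (simp add: ennreal_mult'[symmetric] exp_add[symmetric])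
  finally show ?thesis
    by (simp add: \<kappa>_def)
qed

text \<open>The constants balance: \<eta> makes the cell cost equal to \<epsilon> / 16, and \<tau>
  keeps \<tau> / 2 below \<epsilon> / 16, so a bracket has mean at most exp (- \<epsilon> / 8). The
  condition on h makes the network vary by at most \<eta> over a cell. The final bound - n *
  \<epsilon> / 8 is chosen to cancel the tilt c. The event does not depend on \<theta>, which is the
  uniformity wanted.\<close>

lemma sieve_event:
  assumes \<epsilon>: "0 < \<epsilon>" and \<tau>: "\<tau> = min (\<epsilon> / 8) (1 / 2)" and \<eta>: "\<eta> = \<sigma> * sqrt (\<epsilon> * \<tau>) / 2"
    and C: "0 \<le> C" and h: "0 < h" "(1 + C) * (real (nparams p k) * h) \<le> \<eta>"
  obtains E where "E \<in> sets (data n)"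
    "emeasure (data n) E \<le> ennreal ((2 * C / h + 3) ^ nparams p k * exp (- (n * \<epsilon> / 16)))"
    "\<And>D \<theta>. D \<in> space (data n) - E \<Longrightarrow> (\<And>i. i < n \<Longrightarrow> fst (D i) \<in> unit_cube p) \<Longrightarrow>
      (\<And>i. i < nparams p k \<Longrightarrow> \<bar>\<theta> i\<bar> \<le> C) \<Longrightarrow> \<epsilon> \<le> hellinger p k f0 \<sigma> \<theta> \<Longrightarrow>
      log_ratio p k f0 \<sigma> n \<theta> D \<le> - (n * \<epsilon> / 8)"
proof -
  let ?K = "nparams p k"
  define S where "S = {\<theta>. (\<forall>i<?K. \<bar>\<theta> i\<bar> \<le> C) \<and> \<epsilon> \<le> hellinger p k f0 \<sigma> \<theta>}"
  obtain T where T: "T \<subseteq> S" "finite T" "real (card T) \<le> (2 * C / h + 3) ^ ?K"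
    "\<And>\<theta>. \<theta> \<in> S \<Longrightarrow> \<exists>\<theta>'\<in>T. \<forall>i<?K. \<bar>\<theta> i - \<theta>' i\<bar> \<le> h"
    by (rule cube_net[of S ?K C h]) (use C h in \<open>auto simp: S_def\<close>)
  have \<tau>': "0 < \<tau>" "\<tau> \<le> 1 / 2" "\<tau> / 2 \<le> \<epsilon> / 16"
    using \<epsilon> by (auto simp: \<tau>)
  have \<eta>2: "\<eta>\<^sup>2 / (4 * \<sigma>\<^sup>2 * \<tau>) = \<epsilon> / 16"
    using \<epsilon> \<tau>' \<sigma> by (simp add: \<eta> power_mult_distrib power_divide)
  have exponent: "\<eta>\<^sup>2 / (4 * \<sigma>\<^sup>2 * \<tau>) + \<tau> / 2 - \<epsilon> / 4 \<le> - \<epsilon> / 8"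
    unfolding \<eta>2 using \<tau>'(3) by linarith
  define G where "G \<theta> D = (\<Prod>i<n. ennreal (exp (bracket \<eta> \<tau> k \<theta> (D i))))" for \<theta> D
  have G_meas [measurable]: "G \<theta> \<in> borel_measurable (data n)" for \<theta>
  proof -
    have "(\<lambda>D. bracket \<eta> \<tau> k \<theta> (D i)) \<in> borel_measurable (data n)" if "i < n" for i
      unfolding true_data_measure_def using that
      by (intro measurable_compose[OF measurable_component_singleton[of i]]) auto
    then show ?thesis
      unfolding G_def[abs_def] by auto
  qed
  \<comment> \<open>\<open>G \<theta>\<close> has mean at most exp (- n * \<epsilon> / 8) at a net
    point. The threshold exp (- n * \<epsilon> / 16) spends half of that exponent on the probability
    of the event and keeps the other half for the bound off the event, where the factor 2 of
    \<open>log_ratio_le_bracket\<close> restores it.\<close>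
  define E1 where "E1 \<theta> = {D \<in> space (data n). 1 \<le> ennreal (exp (n * \<epsilon> / 16)) * G \<theta> D}" for \<theta>
  define E where "E = (\<Union>\<theta>\<in>T. E1 \<theta>)"
  have E1_sets: "E1 \<theta> \<in> sets (data n)" for \<theta>
    unfolding E1_def by measurable
  have E1: "emeasure (data n) (E1 \<theta>) \<le> ennreal (exp (- (n * \<epsilon> / 16)))" if "\<theta> \<in> T" for \<theta>
  proof -
    have far: "\<epsilon> \<le> hellinger p k f0 \<sigma> \<theta>"
      using that T(1) by (auto simp: S_def)
    have "(\<integral>\<^sup>+z. ennreal (exp (bracket \<eta> \<tau> k \<theta> z)) \<partial>obs) \<le> ennreal (exp (- \<epsilon> / 8))"
      using exponent by (intro order_trans[OF nn_integral_bracket[OF \<tau>'(1,2) far]] ennreal_leI) simp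
    then have "(\<integral>\<^sup>+D. G \<theta> D \<partial>data n) \<le> ennreal (exp (- \<epsilon> / 8)) ^ n"
      unfolding G_def by (subst nn_integral_data_prod) (auto intro!: power_mono)
    also have "\<dots> = ennreal (exp (- (n * \<epsilon> / 8)))"
      by (simp add: ennreal_power exp_of_nat_mult[symmetric])
    finally have G_le: "(\<integral>\<^sup>+D. G \<theta> D \<partial>data n) \<le> ennreal (exp (- (n * \<epsilon> / 8)))" .
    have "emeasure (data n) (E1 \<theta>) \<le> ennreal (exp (n * \<epsilon> / 16)) * (\<integral>\<^sup>+D. G \<theta> D * indicator (space (data n)) D \<partial>data n)"
      using nn_integral_Markov_inequality[of "G \<theta>" "space (data n)" "data n" "ennreal (exp (n * \<epsilon> / 16))"]
      by (simp add: E1_def)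
    also have "(\<integral>\<^sup>+D. G \<theta> D * indicator (space (data n)) D \<partial>data n) = (\<integral>\<^sup>+D. G \<theta> D \<partial>data n)"
      by (intro nn_integral_cong) auto
    also have "ennreal (exp (n * \<epsilon> / 16)) * (\<integral>\<^sup>+D. G \<theta> D \<partial>data n)
        \<le> ennreal (exp (n * \<epsilon> / 16)) * ennreal (exp (- (n * \<epsilon> / 8)))"
      by (intro mult_left_mono G_le) simp
    also have "\<dots> = ennreal (exp (- (n * \<epsilon> / 16)))"
      by (simp add: ennreal_mult'[symmetric] mult_exp_exp)
    finally show ?thesis .
  qed
  show thesis
  proof
    show "E \<in> sets (data n)"
      unfolding E_def using T(2) E1_sets by auto
    have "emeasure (data n) E \<le> (\<Sum>\<theta>\<in>T. emeasure (data n) (E1 \<theta>))"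
      unfolding E_def using T(2) E1_sets by (intro emeasure_subadditive_finite) auto
    also have "\<dots> \<le> (\<Sum>\<theta>\<in>T. ennreal (exp (- (n * \<epsilon> / 16))))"
      by (intro sum_mono E1)
    also have "\<dots> = ennreal (real (card T) * exp (- (n * \<epsilon> / 16)))"
      by (simp add: ennreal_mult' ennreal_of_nat_eq_real_of_nat)
    also have "\<dots> \<le> ennreal ((2 * C / h + 3) ^ ?K * exp (- (n * \<epsilon> / 16)))"
      by (intro ennreal_leI mult_right_mono T) simp
    finally show "emeasure (data n) E \<le> ennreal ((2 * C / h + 3) ^ ?K * exp (- (n * \<epsilon> / 16)))" .
    fix D \<theta>
    assume D: "D \<in> space (data n) - E" and cube: "\<And>i. i < n \<Longrightarrow> fst (D i) \<in> unit_cube p"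
      and box: "\<And>i. i < ?K \<Longrightarrow> \<bar>\<theta> i\<bar> \<le> C" and far: "\<epsilon> \<le> hellinger p k f0 \<sigma> \<theta>"
    have "\<theta> \<in> S"
      using box far by (auto simp: S_def)
    then obtain \<theta>' where \<theta>': "\<theta>' \<in> T" "\<And>i. i < ?K \<Longrightarrow> \<bar>\<theta> i - \<theta>' i\<bar> \<le> h"
      using T(4) by blast
    have near: "\<bar>nnet p k \<theta> (fst (D i)) - nnet p k \<theta>' (fst (D i))\<bar> \<le> \<eta>" if "i < n" for i
    proof -
      have "\<bar>nnet p k \<theta> (fst (D i)) - nnet p k \<theta>' (fst (D i))\<bar> \<le> (1 + C) * (\<Sum>i<?K. \<bar>\<theta> i - \<theta>' i\<bar>)"
        using cube[OF that] \<theta>'(1) T(1) by (intro nnet_lipschitz) (auto simp: S_def unit_cube_def)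
      also have "\<dots> \<le> (1 + C) * (\<Sum>i<?K. h)"
        using C \<theta>'(2) by (intro mult_left_mono sum_mono) auto
      also have "\<dots> \<le> \<eta>"
        using h by simp
      finally show ?thesis .
    qed
    have "D \<notin> E1 \<theta>'"
      using D \<theta>'(1) by (auto simp: E_def)
    then have "ennreal (exp (n * \<epsilon> / 16)) * G \<theta>' D < 1"
      using D by (auto simp: E1_def)
    also have "G \<theta>' D = ennreal (exp (\<Sum>i<n. bracket \<eta> \<tau> k \<theta>' (D i)))"
      by (simp add: G_def exp_sum prod_ennreal)
    finally have "exp (n * \<epsilon> / 16) * exp (\<Sum>i<n. bracket \<eta> \<tau> k \<theta>' (D i)) < 1"
      by (simp add: ennreal_mult'[symmetric] ennreal_less_one_iff)
    then have "(\<Sum>i<n. bracket \<eta> \<tau> k \<theta>' (D i)) < - (n * \<epsilon> / 16)"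
      by (simp add: mult_exp_exp)
    moreover have "log_ratio p k f0 \<sigma> n \<theta> D \<le> 2 * (\<Sum>i<n. bracket \<eta> \<tau> k \<theta>' (D i))"
      using \<tau>' near by (intro log_ratio_le_bracket) auto
    ultimately show "log_ratio p k f0 \<sigma> n \<theta> D \<le> - (n * \<epsilon> / 8)"
      by simp
  qed
qed

end

section \<open>Prior mass outside the box and the averaged evidence\<close>

lemma prob_space_normal_prior: "0 < \<zeta> \<Longrightarrow> prob_space (normal_prior \<zeta> K)"
  unfolding normal_prior_def by (intro prob_space_PiM prob_space_normal_density)

lemma sets_normal_prior [measurable_cong]: "sets (normal_prior \<zeta> K) = sets (PiM {..<K} (\<lambda>_. borel))"
  unfolding normal_prior_def by (intro sets_PiM_cong) auto

lemma prior_box_complement_sets [measurable]: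
  "{\<theta> \<in> space (normal_prior \<zeta> K). \<exists>i<K. C < \<bar>\<theta> i\<bar>} \<in> sets (normal_prior \<zeta> K)"
proof -
  have "{\<theta> \<in> space (normal_prior \<zeta> K). C < \<bar>\<theta> i\<bar>} \<in> sets (normal_prior \<zeta> K)" if "i < K" for i
  proof -
    have [measurable]: "(\<lambda>\<theta>. \<theta> i) \<in> borel_measurable (normal_prior \<zeta> K)"
      using that by (simp cong: measurable_cong_sets add: sets_normal_prior)
    show ?thesis
      by measurable
  qed
  moreover have "{\<theta> \<in> space (normal_prior \<zeta> K). \<exists>i<K. C < \<bar>\<theta> i\<bar>}
      = (\<Union>i<K. {\<theta> \<in> space (normal_prior \<zeta> K). C < \<bar>\<theta> i\<bar>})"
    by auto
  ultimately show ?thesis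
    by auto
qed

lemma normal_prior_tail:
  assumes \<zeta>: "0 < \<zeta>" and C: "0 \<le> C"
  shows "emeasure (normal_prior \<zeta> K) {\<theta> \<in> space (normal_prior \<zeta> K). \<exists>i<K. C < \<bar>\<theta> i\<bar>}
    \<le> ennreal (K * (sqrt 2 * exp (- C\<^sup>2 / (4 * \<zeta>\<^sup>2))))"
proof -
  let ?P = "normal_prior \<zeta> K" and ?N = "density lborel (\<lambda>t. ennreal (normal_density 0 \<zeta> t))"
  let ?A = "\<lambda>i. {\<theta> \<in> space ?P. C < \<bar>\<theta> i\<bar>}"
  have meas: "(\<lambda>\<theta>. \<theta> i) \<in> measurable ?P ?N" if "i < K" for i
    unfolding normal_prior_def using that by (intro measurable_component_singleton) auto
  have tail: "emeasure ?P (?A i) \<le> ennreal (sqrt 2 * exp (- C\<^sup>2 / (4 * \<zeta>\<^sup>2)))" if "i < K" for i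
  proof -
    have "distr ?P ?N (\<lambda>\<theta>. \<theta> i) = ?N"
      unfolding normal_prior_def using that prob_space_normal_density[OF \<zeta>]
        distr_PiM_component[of "{..<K}" "\<lambda>_. ?N" i] by simp
    then have "emeasure ?N {t. C < \<bar>t\<bar>} = emeasure (distr ?P ?N (\<lambda>\<theta>. \<theta> i)) {t. C < \<bar>t\<bar>}"
      by simp
    also have "\<dots> = emeasure ?P (?A i)"
      using meas[OF that] by (subst emeasure_distr) (auto intro!: arg_cong[where f = "emeasure ?P"])
    finally show ?thesis
      using normal_tail[OF \<zeta> C] by (simp add: emeasure_density)
  qed
  have A: "?A i \<in> sets ?P" if "i < K" for i
    using measurable_sets[OF meas[OF that], of "{t. C < \<bar>t\<bar>}"] by (simp add: vimage_def Int_def conj_commute)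
  have "{\<theta> \<in> space ?P. \<exists>i<K. C < \<bar>\<theta> i\<bar>} = (\<Union>i<K. ?A i)"
    by auto
  then have "emeasure ?P {\<theta> \<in> space ?P. \<exists>i<K. C < \<bar>\<theta> i\<bar>} \<le> (\<Sum>i<K. emeasure ?P (?A i))"
    using A by (simp only:) (intro emeasure_subadditive_finite, auto)
  also have "\<dots> \<le> (\<Sum>i<K. ennreal (sqrt 2 * exp (- C\<^sup>2 / (4 * \<zeta>\<^sup>2))))"
    by (intro sum_mono tail) auto
  also have "\<dots> = ennreal (K * (sqrt 2 * exp (- C\<^sup>2 / (4 * \<zeta>\<^sup>2))))"
    by (simp add: ennreal_mult' ennreal_of_nat_eq_real_of_nat)
  finally show ?thesis .
qed

context nnet_regression
begin

lemma log_ratio_measurable_param [measurable]: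
  "(\<lambda>\<theta>. log_ratio p k f0 \<sigma> n \<theta> D) \<in> borel_measurable (PiM {..<nparams p k} (\<lambda>_. borel))"
  unfolding log_ratio_def
  by (intro borel_measurable_sum borel_measurable_divide borel_measurable_diff borel_measurable_power
    borel_measurable_const nnet_measurable) auto

lemma log_ratio_measurable_pair:
  assumes M: "sets M = sets (PiM {..<nparams p k} (\<lambda>_. borel))"
  shows "(\<lambda>(\<theta>, D). log_ratio p k f0 \<sigma> n \<theta> D) \<in> borel_measurable (M \<Otimes>\<^sub>M data n)"
proof -
  have D: "(\<lambda>w. snd w i) \<in> measurable (M \<Otimes>\<^sub>M data n) (covariate_measure p \<Otimes>\<^sub>M lborel)" if "i < n" for i
  proof -
    have "(\<lambda>w. snd w i) \<in> measurable (M \<Otimes>\<^sub>M data n) obs"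
      unfolding true_data_measure_def using that
      by (intro measurable_compose[OF measurable_snd measurable_component_singleton]) auto
    then show ?thesis
      by (simp cong: measurable_cong_sets)
  qed
  have x: "(\<lambda>w. fst (snd w i)) \<in> measurable (M \<Otimes>\<^sub>M data n) (covariate_measure p)" if "i < n" for i
    by (rule measurable_compose[OF D[OF that] measurable_fst])
  have y: "(\<lambda>w. snd (snd w i)) \<in> borel_measurable (M \<Otimes>\<^sub>M data n)" if "i < n" for i
    using measurable_compose[OF D[OF that] measurable_snd] by simp
  have xh: "(\<lambda>w. fst (snd w i) h) \<in> borel_measurable (M \<Otimes>\<^sub>M data n)" if "i < n" "h < p" for i h
  proof (rule measurable_compose[OF x[OF that(1)]])
    show "(\<lambda>x. x h) \<in> borel_measurable (covariate_measure p)"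
      using that(2) by (simp cong: measurable_cong_sets add: sets_covariate_measure)
  qed
  have \<theta>: "(\<lambda>w. fst w i) \<in> borel_measurable (M \<Otimes>\<^sub>M data n)" if "i < nparams p k" for i
  proof (rule measurable_compose[OF measurable_fst])
    show "(\<lambda>\<theta>. \<theta> i) \<in> borel_measurable M"
      using that by (simp cong: measurable_cong_sets add: M)
  qed
  show ?thesis
    unfolding log_ratio_def split_beta'
    using x y xh \<theta> measurable_compose[OF x f0]
    by (intro borel_measurable_sum borel_measurable_divide borel_measurable_diff borel_measurable_power
      borel_measurable_const nnet_measurable) auto
qed

text \<open>By Tonelli and the unit mean of the likelihood ratio, only the prior integral of the
  weight remains. The summand 1 accounts for the plain evidence; the summand with c will pay for the
  exponential tilt outside the box.\<close>

lemma expected_evidence: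
  fixes k n :: nat and \<zeta> C c :: real
  assumes \<zeta>: "0 < \<zeta>" and C: "0 \<le> C" and c: "0 \<le> c"
  defines "pr \<equiv> normal_prior \<zeta> (nparams p k)"
  defines "F \<equiv> {\<theta> \<in> space pr. \<exists>i<nparams p k. C < \<bar>\<theta> i\<bar>}"
  defines "Z \<equiv> \<lambda>D. \<integral>\<^sup>+\<theta>. ennreal (exp (log_ratio p k f0 \<sigma> n \<theta> D)) * (1 + ennreal c * indicator F \<theta>) \<partial>pr"
  shows "Z \<in> borel_measurable (data n)"
    and "(\<integral>\<^sup>+D. Z D \<partial>data n) \<le> ennreal (1 + c * (nparams p k * (sqrt 2 * exp (- C\<^sup>2 / (4 * \<zeta>\<^sup>2)))))"
proof -
  interpret pr: prob_space pr
    unfolding pr_def by (rule prob_space_normal_prior[OF \<zeta>])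
  interpret D: prob_space "data n"
    by (rule prob_space_data)
  interpret pair_sigma_finite "data n" pr
    by unfold_locales
  interpret sw: pair_sigma_finite pr "data n"
    by unfold_locales
  have sets_pr: "sets pr = sets (PiM {..<nparams p k} (\<lambda>_. borel))"
    unfolding pr_def by (rule sets_normal_prior)
  have F [measurable]: "F \<in> sets pr"
    unfolding F_def pr_def by (rule prior_box_complement_sets)
  note log_ratio_measurable_pair[OF sets_pr, of n, measurable]
  have meas: "(\<lambda>(\<theta>, D). ennreal (exp (log_ratio p k f0 \<sigma> n \<theta> D)) * (1 + ennreal c * indicator F \<theta>))
      \<in> borel_measurable (pr \<Otimes>\<^sub>M data n)"
    unfolding split_beta'
    using log_ratio_measurable_pair[OF sets_pr, of n] unfolding split_beta' by measurable
  have meas': "(\<lambda>(D, \<theta>). ennreal (exp (log_ratio p k f0 \<sigma> n \<theta> D)) * (1 + ennreal c * indicator F \<theta>))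
      \<in> borel_measurable (data n \<Otimes>\<^sub>M pr)"
    using measurable_compose[OF measurable_pair_swap' meas] by (simp add: split_beta')
  show "Z \<in> borel_measurable (data n)"
    unfolding Z_def using pr.borel_measurable_nn_integral[OF meas'] by simp
  have single: "(\<integral>\<^sup>+D. ennreal (exp (log_ratio p k f0 \<sigma> n \<theta> D)) * (1 + ennreal c * indicator F \<theta>) \<partial>data n)
      = 1 + ennreal c * indicator F \<theta>" if "\<theta> \<in> space pr" for \<theta>
  proof -
    have "(\<lambda>D. ennreal (exp (log_ratio p k f0 \<sigma> n \<theta> D))) \<in> borel_measurable (data n)"
      using measurable_Pair2[OF log_ratio_measurable_pair[OF sets_pr, of n] that] by simp
    then show ?thesis
      by (subst nn_integral_multc) (auto simp: nn_integral_exp_log_ratio)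
  qed
  have "(\<integral>\<^sup>+D. Z D \<partial>data n) = (\<integral>\<^sup>+\<theta>. (\<integral>\<^sup>+D. ennreal (exp (log_ratio p k f0 \<sigma> n \<theta> D)) * (1 + ennreal c * indicator F \<theta>) \<partial>data n) \<partial>pr)"
    unfolding Z_def by (rule sw.Fubini'[OF meas])
  also have "\<dots> = (\<integral>\<^sup>+\<theta>. 1 + ennreal c * indicator F \<theta> \<partial>pr)"
    by (intro nn_integral_cong single)
  also have "\<dots> = 1 + ennreal c * emeasure pr F"
    by (subst nn_integral_add) (auto simp: nn_integral_cmult pr.emeasure_space_1)
  also have "\<dots> \<le> 1 + ennreal c * ennreal (nparams p k * (sqrt 2 * exp (- C\<^sup>2 / (4 * \<zeta>\<^sup>2))))"
    using normal_prior_tail[OF \<zeta> C, of "nparams p k"] by (intro add_left_mono mult_left_mono) (auto simp: F_def pr_def)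
  also have "\<dots> = ennreal (1 + c * (nparams p k * (sqrt 2 * exp (- C\<^sup>2 / (4 * \<zeta>\<^sup>2)))))"
    using c by (simp add: ennreal_mult'[symmetric])
  finally show "(\<integral>\<^sup>+D. Z D \<partial>data n) \<le> ennreal (1 + c * (nparams p k * (sqrt 2 * exp (- C\<^sup>2 / (4 * \<zeta>\<^sup>2)))))" .
qed

end

section \<open>The variational loss\<close>

definition mean_field_normal :: "nat \<Rightarrow> (nat \<Rightarrow> real) \<Rightarrow> (nat \<Rightarrow> real) \<Rightarrow> (nat \<Rightarrow> real) measure" where
  "mean_field_normal K m s = PiM {..<K} (\<lambda>i. density lborel (\<lambda>t. ennreal (normal_density (m i) (s i) t)))"

text \<open>The logarithm of the product density: the integrand of the divergence from the prior
  becomes a quadratic polynomial, integrable under every Gaussian product.\<close>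

definition log_normal :: "nat \<Rightarrow> (nat \<Rightarrow> real) \<Rightarrow> (nat \<Rightarrow> real) \<Rightarrow> (nat \<Rightarrow> real) \<Rightarrow> real" where
  "log_normal K m s \<theta> = (\<Sum>i<K. - ln (sqrt (2 * pi * (s i)\<^sup>2)) - (\<theta> i - m i)\<^sup>2 / (2 * (s i)\<^sup>2))"

lemma mean_field_family_eq:
  "mean_field_family K = {mean_field_normal K m s | m s. \<forall>i<K. 0 < s i}"
  by (simp add: mean_field_family_def mean_field_normal_def)

lemma normal_prior_eq: "normal_prior \<zeta> K = mean_field_normal K (\<lambda>_. 0) (\<lambda>_. \<zeta>)"
  by (simp add: normal_prior_def mean_field_normal_def)

lemma sets_mean_field_normal [measurable_cong, simp]:
  "sets (mean_field_normal K m s) = sets (PiM {..<K} (\<lambda>_. borel))"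
  unfolding mean_field_normal_def by (intro sets_PiM_cong) auto

lemma log_normal_measurable [measurable]:
  "log_normal K m s \<in> borel_measurable (PiM {..<K} (\<lambda>_. borel))"
  unfolding log_normal_def[abs_def] by measurable

lemma sets_PiM_lborel [measurable_cong]:
  "sets (PiM I (\<lambda>_. lborel :: real measure)) = sets (PiM I (\<lambda>_. borel))"
  by (intro sets_PiM_cong) auto

locale mean_field =
  fixes K :: nat and m s :: "nat \<Rightarrow> real"
  assumes s: "i < K \<Longrightarrow> 0 < s i"
begin

abbreviation q :: "(nat \<Rightarrow> real) measure" where
  "q \<equiv> mean_field_normal K m s"

lemma exp_log_normal: "exp (log_normal K m s \<theta>) = (\<Prod>i<K. normal_density (m i) (s i) (\<theta> i))"
  unfolding log_normal_def exp_sum[OF finite_lessThan]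
proof (rule prod.cong[OF refl])
  fix i assume "i \<in> {..<K}"
  then have "0 < sqrt (2 * pi * (s i)\<^sup>2)"
    using s[of i] by (simp add: zero_less_mult_iff)
  then show "exp (- ln (sqrt (2 * pi * (s i)\<^sup>2)) - (\<theta> i - m i)\<^sup>2 / (2 * (s i)\<^sup>2)) = normal_density (m i) (s i) (\<theta> i)"
    by (simp only: exp_diff exp_minus exp_ln) (simp add: normal_density_def exp_minus field_simps)
qed

lemma q_density: "q = density (PiM {..<K} (\<lambda>_. lborel)) (\<lambda>\<theta>. ennreal (exp (log_normal K m s \<theta>)))"
  unfolding exp_log_normal mean_field_normal_def using s
  by (intro PiM_density_lborel) (auto simp: nn_integral_normal_density)

sublocale prob_space q
  unfolding mean_field_normal_def using s by (intro prob_space_PiM prob_space_normal_density) auto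

lemma distr_q:
  assumes "i < K"
  shows "distr q (density lborel (\<lambda>t. ennreal (normal_density (m i) (s i) t))) (\<lambda>\<theta>. \<theta> i)
    = density lborel (\<lambda>t. ennreal (normal_density (m i) (s i) t))"
  unfolding mean_field_normal_def
  using assms s by (intro distr_PiM_component prob_space_normal_density) auto

text \<open>The i-th marginal of q is its i-th factor, so the moments needed later reduce to
  one-dimensional normal moments.\<close>

lemma has_integral_component:
  assumes i: "i < K" and g: "g \<in> borel_measurable borel"
    and int: "has_bochner_integral lborel (\<lambda>t. normal_density (m i) (s i) t * g t) (v::real)"
  shows "has_bochner_integral q (\<lambda>\<theta>. g (\<theta> i)) v"
proof -
  let ?N = "density lborel (\<lambda>t. ennreal (normal_density (m i) (s i) t))"
  have comp: "(\<lambda>\<theta>. \<theta> i) \<in> measurable q ?N"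
    unfolding mean_field_normal_def using i by (intro measurable_component_singleton) auto
  have "has_bochner_integral ?N g v"
    using int g by (intro has_bochner_integral_density) auto
  then have "has_bochner_integral (distr q ?N (\<lambda>\<theta>. \<theta> i)) g v"
    by (simp add: distr_q[OF i])
  then show ?thesis
    using comp g by (simp add: has_bochner_integral_iff integrable_distr_eq integral_distr)
qed

lemma centered_moment:
  assumes i: "i < K"
  shows "has_bochner_integral q (\<lambda>\<theta>. (\<theta> i - m i)\<^sup>2) ((s i)\<^sup>2)"
  using normal_moment_even[OF s[OF i], of "m i" 1] by (intro has_integral_component i) simp_all

lemma second_moment:
  assumes i: "i < K"
  shows "has_bochner_integral q (\<lambda>\<theta>. (\<theta> i)\<^sup>2) ((s i)\<^sup>2 + (m i)\<^sup>2)"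
proof -
  have first: "has_bochner_integral q (\<lambda>\<theta>. \<theta> i) (m i)"
    using normal_moment_nz_1[OF s[OF i], of "m i"] by (intro has_integral_component i) auto
  have "has_bochner_integral q (\<lambda>\<theta>. (\<theta> i - m i)\<^sup>2 + 2 * m i * \<theta> i - (m i)\<^sup>2) ((s i)\<^sup>2 + 2 * m i * m i - (m i)\<^sup>2)"
    by (intro has_bochner_integral_add has_bochner_integral_diff has_bochner_integral_mult_right
        centered_moment i first) (auto simp: has_bochner_integral_iff prob_space)
  then show ?thesis
    by (simp add: power2_eq_square algebra_simps)
qed

lemma integrable_component_square: "i < K \<Longrightarrow> integrable q (\<lambda>\<theta>. (\<theta> i)\<^sup>2)"
  using second_moment by (auto simp: has_bochner_integral_iff)

lemma integrable_log_normal: "integrable q (log_normal K m' s')"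
proof -
  have "integrable q (\<lambda>\<theta>. (\<theta> i - c)\<^sup>2)" if i: "i < K" for i c
  proof -
    have "integrable q (\<lambda>\<theta>. \<theta> i)"
      using has_integral_component[OF i _ normal_moment_nz_1[OF s[OF i], of "m i"]]
      by (auto simp: has_bochner_integral_iff)
    then have "integrable q (\<lambda>\<theta>. (\<theta> i)\<^sup>2 - 2 * c * \<theta> i + c\<^sup>2)"
      using integrable_component_square[OF i] by auto
    then show ?thesis
      by (simp add: power2_eq_square algebra_simps)
  qed
  then show ?thesis
    unfolding log_normal_def[abs_def] by (intro Bochner_Integration.integrable_sum Bochner_Integration.integrable_diff integrable_divide) auto
qed

end

text \<open>Cauchy-Schwarz applied to \<open>nnet_abs_le\<close>. Although the network is not
  polynomial in its parameters, a quadratic polynomial dominates its square; this makes the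
  log-likelihood integrable under Gaussian products.\<close>

lemma nnet_square_le:
  fixes \<theta> :: "nat \<Rightarrow> real"
  shows "(nnet p k \<theta> x)\<^sup>2 \<le> nparams p k * (\<Sum>i<nparams p k. (\<theta> i)\<^sup>2)"
proof -
  have "(nnet p k \<theta> x)\<^sup>2 \<le> (\<Sum>i<nparams p k. \<bar>\<theta> i\<bar>)\<^sup>2"
    using nnet_abs_le[of p k \<theta> x] by (simp add: abs_le_square_iff[symmetric])
  also have "\<dots> \<le> (\<Sum>i<nparams p k. \<bar>\<theta> i\<bar>\<^sup>2) * card {..<nparams p k}"
    by (rule sum_squared_le_sum_of_squares)
  finally show ?thesis
    by (simp add: mult.commute)
qed

context nnet_regression
begin

lemma integrable_log_ratio:
  assumes "mean_field (nparams p k) s"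
  shows "integrable (mean_field_normal (nparams p k) m s) (\<lambda>\<theta>. log_ratio p k f0 \<sigma> n \<theta> D)"
proof -
  interpret mean_field "nparams p k" m s by fact
  have [measurable]: "(\<lambda>\<theta>. nnet p k \<theta> x) \<in> borel_measurable q" for x
    by (rule nnet_measurable) auto
  have sq: "integrable q (\<lambda>\<theta>. (nnet p k \<theta> x)\<^sup>2)" for x
  proof (rule Bochner_Integration.integrable_bound)
    show "integrable q (\<lambda>\<theta>. nparams p k * (\<Sum>i<nparams p k. (\<theta> i)\<^sup>2))"
      by (intro integrable_mult_right Bochner_Integration.integrable_sum integrable_component_square) auto
  qed (use nnet_square_le[of p k _ x] in \<open>auto intro!: AE_I2 order_trans[OF _ abs_ge_self]\<close>)
  have "integrable q (\<lambda>\<theta>. nnet p k \<theta> x)" for x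
  proof (rule Bochner_Integration.integrable_bound)
    show "integrable q (\<lambda>\<theta>. 1 + (nnet p k \<theta> x)\<^sup>2)"
      using sq by auto
    have "\<bar>u\<bar> \<le> 1 + u\<^sup>2" for u :: real
      using zero_le_power2[of "\<bar>u\<bar> - 1"] zero_le_power2[of u] by (simp add: power2_diff)
    then show "AE \<theta> in q. norm (nnet p k \<theta> x) \<le> norm (1 + (nnet p k \<theta> x)\<^sup>2)"
      by (auto intro!: AE_I2 order_trans[OF _ abs_ge_self])
  qed auto
  then have "integrable q (\<lambda>\<theta>. (y - nnet p k \<theta> x)\<^sup>2)" for x y
    using sq by (auto simp: power2_diff)
  then show ?thesis
    unfolding log_ratio_def by (intro Bochner_Integration.integrable_sum Bochner_Integration.integrable_diff integrable_divide) auto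
qed

definition variational_loss where
  "variational_loss \<zeta> k n D m s = (\<integral>\<theta>. log_normal (nparams p k) m s \<theta>
      - log_normal (nparams p k) (\<lambda>_. 0) (\<lambda>_. \<zeta>) \<theta> - log_ratio p k f0 \<sigma> n \<theta> D \<partial>mean_field_normal (nparams p k) m s)"

lemma likelihood_eq:
  "likelihood p k \<sigma> n \<theta> D = (\<Prod>i<n. normal_density (f0 (fst (D i))) \<sigma> (snd (D i))) * exp (log_ratio p k f0 \<sigma> n \<theta> D)"
  unfolding likelihood_def log_ratio_def exp_sum[OF finite_lessThan] prod.distrib[symmetric]
  by (intro prod.cong refl) (simp add: normal_density_mult_exp[OF \<sigma>])

lemma likelihood_pos: "0 < likelihood p k \<sigma> n \<theta> D"
  unfolding likelihood_def by (intro prod_pos) (simp add: normal_density_pos \<sigma>)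

text \<open>\<open>posterior\<close> divides by this Bochner integral, which would be 0 for a
  nonintegrable likelihood. Normal densities are bounded by their peak, so the likelihood is
  bounded, hence integrable; being strictly positive, it cannot integrate to 0.\<close>

lemma evidence_pos:
  assumes \<zeta>: "0 < \<zeta>"
  shows "0 < (\<integral>\<theta>. likelihood p k \<sigma> n \<theta> D \<partial>normal_prior \<zeta> (nparams p k))"
proof -
  interpret pr: prob_space "normal_prior \<zeta> (nparams p k)"
    by (rule prob_space_normal_prior[OF \<zeta>])
  have [measurable]: "(\<lambda>\<theta>. likelihood p k \<sigma> n \<theta> D) \<in> borel_measurable (normal_prior \<zeta> (nparams p k))"
    unfolding likelihood_eq by measurable
  have int: "integrable (normal_prior \<zeta> (nparams p k)) (\<lambda>\<theta>. likelihood p k \<sigma> n \<theta> D)"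
  proof (rule pr.integrable_const_bound[where B = "(1 / sqrt (2 * pi * \<sigma>\<^sup>2)) ^ n"])
    have "normal_density \<mu> \<sigma> y \<le> 1 / sqrt (2 * pi * \<sigma>\<^sup>2)" for \<mu> y
      unfolding normal_density_def by (rule mult_left_le) auto
    then have "likelihood p k \<sigma> n \<theta> D \<le> (\<Prod>i<n. 1 / sqrt (2 * pi * \<sigma>\<^sup>2))" for \<theta>
      unfolding likelihood_def by (intro prod_mono) auto
    then show "AE \<theta> in normal_prior \<zeta> (nparams p k). norm (likelihood p k \<sigma> n \<theta> D) \<le> (1 / sqrt (2 * pi * \<sigma>\<^sup>2)) ^ n"
      using likelihood_pos[of k n _ D] by (auto intro!: AE_I2 simp: abs_of_pos)
  qed measurable
  have "(\<integral>\<theta>. likelihood p k \<sigma> n \<theta> D \<partial>normal_prior \<zeta> (nparams p k)) \<noteq> 0"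
  proof
    assume "(\<integral>\<theta>. likelihood p k \<sigma> n \<theta> D \<partial>normal_prior \<zeta> (nparams p k)) = 0"
    then have "AE \<theta> in normal_prior \<zeta> (nparams p k). likelihood p k \<sigma> n \<theta> D = 0"
      using int likelihood_pos[of k n _ D]
      by (subst (asm) integral_nonneg_eq_0_iff_AE) (auto intro: less_imp_le)
    then have "AE \<theta> in normal_prior \<zeta> (nparams p k). False"
      by (rule AE_mp) (use likelihood_pos[of k n _ D] in \<open>auto simp: less_le intro!: AE_I2\<close>)
    then show False
      using pr.AE_False by simp
  qed
  moreover have "0 \<le> (\<integral>\<theta>. likelihood p k \<sigma> n \<theta> D \<partial>normal_prior \<zeta> (nparams p k))"
    using likelihood_pos[of k n _ D] by (intro integral_nonneg_AE) (auto intro: less_imp_le)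
  ultimately show ?thesis
    by simp
qed

lemma dKL_posterior:
  assumes \<zeta>: "0 < \<zeta>" and mf: "mean_field (nparams p k) s"
  shows "dKL (mean_field_normal (nparams p k) m s) (posterior p k \<sigma> \<zeta> n D) = variational_loss \<zeta> k n D m s
    + (ln (\<integral>\<theta>. likelihood p k \<sigma> n \<theta> D \<partial>normal_prior \<zeta> (nparams p k))
      - ln (\<Prod>i<n. normal_density (f0 (fst (D i))) \<sigma> (snd (D i))))"
proof -
  let ?K = "nparams p k"
  let ?\<Lambda> = "PiM {..<?K} (\<lambda>_. lborel :: real measure)"
  define Z where "Z = (\<integral>\<theta>. likelihood p k \<sigma> n \<theta> D \<partial>normal_prior \<zeta> ?K)"
  define L0 where "L0 = (\<Prod>i<n. normal_density (f0 (fst (D i))) \<sigma> (snd (D i)))"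
  let ?l = "\<lambda>\<theta>. log_ratio p k f0 \<sigma> n \<theta> D"
  let ?\<pi> = "log_normal ?K (\<lambda>_. 0) (\<lambda>_. \<zeta>)" and ?q = "log_normal ?K m s"
  interpret mean_field ?K m s by fact
  interpret pr: mean_field ?K "\<lambda>_. 0" "\<lambda>_. \<zeta>"
    by unfold_locales (rule \<zeta>)
  interpret L: product_sigma_finite "\<lambda>_::nat. lborel :: real measure"
    by unfold_locales
  interpret \<Lambda>: sigma_finite_measure ?\<Lambda>
    by (rule L.sigma_finite) simp
  have Z: "0 < Z"
    unfolding Z_def by (rule evidence_pos[OF \<zeta>])
  have L0: "0 < L0"
    unfolding L0_def by (intro prod_pos) (simp add: normal_density_pos \<sigma>)
  have [measurable]: "(\<lambda>\<theta>. ?l \<theta>) \<in> borel_measurable ?\<Lambda>"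
    by measurable
  have post: "posterior p k \<sigma> \<zeta> n D = density ?\<Lambda> (\<lambda>\<theta>. ennreal (exp (?\<pi> \<theta> + ?l \<theta>) * (L0 / Z)))"
  proof -
    have "posterior p k \<sigma> \<zeta> n D = density (density ?\<Lambda> (\<lambda>\<theta>. ennreal (exp (?\<pi> \<theta>))))
        (\<lambda>\<theta>. ennreal (likelihood p k \<sigma> n \<theta> D / Z))"
      unfolding posterior_def Let_def Z_def[symmetric] unfolding normal_prior_eq pr.q_density ..
    also have "\<dots> = density ?\<Lambda> (\<lambda>\<theta>. ennreal (exp (?\<pi> \<theta>)) * ennreal (likelihood p k \<sigma> n \<theta> D / Z))"
      unfolding likelihood_eq by (rule density_density_eq) measurable
    also have "\<dots> = density ?\<Lambda> (\<lambda>\<theta>. ennreal (exp (?\<pi> \<theta> + ?l \<theta>) * (L0 / Z)))"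
      unfolding likelihood_eq L0_def[symmetric]
      by (simp add: ennreal_mult'[symmetric] exp_add mult_ac)
    finally show ?thesis .
  qed
  have "dKL q (posterior p k \<sigma> \<zeta> n D)
      = (\<integral>\<theta>. exp (?q \<theta>) * log (exp 1) (exp (?q \<theta>) / (exp (?\<pi> \<theta> + ?l \<theta>) * (L0 / Z))) \<partial>?\<Lambda>)"
    unfolding dKL_def post unfolding q_density
    using L0 Z by (intro \<Lambda>.KL_density_density) auto
  also have "\<dots> = (\<integral>\<theta>. exp (?q \<theta>) * (?q \<theta> - ?\<pi> \<theta> - ?l \<theta> + (ln Z - ln L0)) \<partial>?\<Lambda>)"
    using L0 Z by (intro Bochner_Integration.integral_cong refl)
      (simp add: log_def ln_div ln_mult algebra_simps)
  also have "\<dots> = (\<integral>\<theta>. ?q \<theta> - ?\<pi> \<theta> - ?l \<theta> + (ln Z - ln L0) \<partial>q)"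
    unfolding q_density by (subst integral_density) auto
  \<comment> \<open>Taking the constant out requires integrability of the rest; otherwise both
    integrals would take the default value 0.\<close>
  also have "\<dots> = (\<integral>\<theta>. ?q \<theta> - ?\<pi> \<theta> - ?l \<theta> \<partial>q) + (\<integral>\<theta>. ln Z - ln L0 \<partial>q)"
    using integrable_log_normal integrable_log_ratio[OF mf]
    by (intro Bochner_Integration.integral_add Bochner_Integration.integrable_diff) auto
  finally show ?thesis
    by (simp add: variational_loss_def Z_def L0_def prob_space)
qed

text \<open>The Donsker--Varadhan inequality, obtained by integrating \<open>w \<le> exp w - 1\<close>.\<close>
lemma variational_loss_ge:
  assumes \<zeta>: "0 < \<zeta>" and mf: "mean_field (nparams p k) s"
    and A: "A \<in> sets (PiM {..<nparams p k} (\<lambda>_. borel))" and M: "0 < M"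
    and bound: "(\<integral>\<^sup>+\<theta>. ennreal (exp (c * indicator A \<theta> + log_ratio p k f0 \<sigma> n \<theta> D)) \<partial>normal_prior \<zeta> (nparams p k)) \<le> ennreal M"
  shows "c * measure (mean_field_normal (nparams p k) m s) A \<le> variational_loss \<zeta> k n D m s + ln M"
proof -
  let ?K = "nparams p k"
  let ?\<Lambda> = "PiM {..<?K} (\<lambda>_. lborel :: real measure)"
  let ?l = "\<lambda>\<theta>. log_ratio p k f0 \<sigma> n \<theta> D"
  let ?\<pi> = "log_normal ?K (\<lambda>_. 0) (\<lambda>_. \<zeta>)" and ?q = "log_normal ?K m s"
  interpret mean_field ?K m s by fact
  interpret pr: mean_field ?K "\<lambda>_. 0" "\<lambda>_. \<zeta>"
    by unfold_locales (rule \<zeta>)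
  note A [measurable]
  \<comment> \<open>exp w is the prior density tilted by exp (c * indicator A + l) and divided by M,
    relative to the density of q. Hence \<open>bound\<close> makes its mean under q at most
    1.\<close>
  define w where "w \<theta> = (c * indicator A \<theta> - ln M) - (?q \<theta> - ?\<pi> \<theta> - ?l \<theta>)" for \<theta>
  have [measurable]: "w \<in> borel_measurable (PiM {..<?K} (\<lambda>_. borel))"
    unfolding w_def[abs_def] by measurable
  have int_loss: "integrable q (\<lambda>\<theta>. ?q \<theta> - ?\<pi> \<theta> - ?l \<theta>)"
    using integrable_log_normal integrable_log_ratio[OF mf] by (intro Bochner_Integration.integrable_diff) auto
  have int_ind: "integrable q (\<lambda>\<theta>. c * indicator A \<theta> - ln M)"
    using A by (intro Bochner_Integration.integrable_diff integrable_mult_right) (auto simp: integrable_indicator_iff less_top[symmetric])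
  have int_w: "integrable q w"
    unfolding w_def using int_loss int_ind by (rule Bochner_Integration.integrable_diff[rotated])
  have le1: "(\<integral>\<^sup>+\<theta>. ennreal (exp (w \<theta>)) \<partial>q) \<le> 1"
  proof -
    have "(\<integral>\<^sup>+\<theta>. ennreal (exp (w \<theta>)) \<partial>q) = (\<integral>\<^sup>+\<theta>. ennreal (exp (?q \<theta>)) * ennreal (exp (w \<theta>)) \<partial>?\<Lambda>)"
      unfolding q_density by (rule nn_integral_density) measurable
    also have "\<dots> = (\<integral>\<^sup>+\<theta>. ennreal (1 / M) * (ennreal (exp (?\<pi> \<theta>)) * ennreal (exp (c * indicator A \<theta> + ?l \<theta>))) \<partial>?\<Lambda>)"
    proof (intro nn_integral_cong)
      fix \<theta>
      have M': "exp (- ln M + z) = 1 / M * exp z" for z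
        using M by (simp add: exp_diff)
      have "?q \<theta> + w \<theta> = - ln M + (?\<pi> \<theta> + (c * indicator A \<theta> + ?l \<theta>))"
        by (simp add: w_def)
      then have "exp (?q \<theta>) * exp (w \<theta>) = 1 / M * (exp (?\<pi> \<theta>) * exp (c * indicator A \<theta> + ?l \<theta>))"
        by (simp only: mult_exp_exp M')
      then show "ennreal (exp (?q \<theta>)) * ennreal (exp (w \<theta>)) = ennreal (1 / M) * (ennreal (exp (?\<pi> \<theta>)) * ennreal (exp (c * indicator A \<theta> + ?l \<theta>)))"
        using M by (simp only: ennreal_mult'[symmetric] exp_ge_zero) (simp add: ennreal_mult'[symmetric])
    qed
    also have "\<dots> = ennreal (1 / M) * (\<integral>\<^sup>+\<theta>. ennreal (exp (?\<pi> \<theta>)) * ennreal (exp (c * indicator A \<theta> + ?l \<theta>)) \<partial>?\<Lambda>)"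
      by (rule nn_integral_cmult) measurable
    also have "(\<integral>\<^sup>+\<theta>. ennreal (exp (?\<pi> \<theta>)) * ennreal (exp (c * indicator A \<theta> + ?l \<theta>)) \<partial>?\<Lambda>)
        = (\<integral>\<^sup>+\<theta>. ennreal (exp (c * indicator A \<theta> + ?l \<theta>)) \<partial>normal_prior \<zeta> ?K)"
      unfolding normal_prior_eq pr.q_density by (rule nn_integral_density[symmetric]) measurable
    also have "ennreal (1 / M) * \<dots> \<le> ennreal (1 / M) * ennreal M"
      by (intro mult_left_mono bound) simp
    also have "\<dots> = 1"
      using M by (simp add: ennreal_mult'[symmetric])
    finally show ?thesis .
  qed
  have int_exp: "integrable q (\<lambda>\<theta>. exp (w \<theta>))"
    using le1 by (intro integrableI_bounded) (auto simp: le_less_trans[OF _ ennreal_one_less_top])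
  have "ennreal (\<integral>\<theta>. exp (w \<theta>) \<partial>q) \<le> ennreal 1"
    using le1 by (subst nn_integral_eq_integral[symmetric]) (auto simp: int_exp)
  then have "(\<integral>\<theta>. exp (w \<theta>) \<partial>q) \<le> 1"
    by (subst (asm) ennreal_le_iff) auto
  moreover have "(\<integral>\<theta>. w \<theta> \<partial>q) \<le> (\<integral>\<theta>. exp (w \<theta>) - 1 \<partial>q)"
  proof (rule integral_mono)
    fix \<theta>
    show "w \<theta> \<le> exp (w \<theta>) - 1"
      using exp_ge_add_one_self[of "w \<theta>"] by linarith
  qed (use int_w int_exp in auto)
  ultimately have "(\<integral>\<theta>. w \<theta> \<partial>q) \<le> 0"
    using int_exp by (simp add: prob_space)
  also have "(\<integral>\<theta>. w \<theta> \<partial>q) = (\<integral>\<theta>. c * indicator A \<theta> - ln M \<partial>q) - variational_loss \<zeta> k n D m s"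
    unfolding w_def variational_loss_def by (rule Bochner_Integration.integral_diff[OF int_ind int_loss])
  also have "(\<integral>\<theta>. c * indicator A \<theta> - ln M \<partial>q) = c * measure q A - ln M"
    using A by (subst Bochner_Integration.integral_diff)
      (auto simp: prob_space integrable_indicator_iff less_top[symmetric] sets.Int_space_eq2)
  finally show ?thesis
    by simp
qed

section \<open>Upper bound for the loss of the Gaussian competitor\<close>

text \<open>A bound, depending on the data alone, for minus the log-ratio averaged over the
  competitor. \<rho> is the weight of Young's inequality for the product of noise and regression
  error, and b^2 stands for the mean squared change of the network under the Gaussian. For \<rho> >
  0 all summands are nonnegative, so Markov's inequality applies.\<close>

definition excess_loss where
  "excess_loss k \<theta> \<rho> b n D = (\<Sum>i<n. ((1 + 1 / \<rho>) * (2 * (nnet p k \<theta> (fst (D i)) - f0 (fst (D i)))\<^sup>2 + 2 * b\<^sup>2)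
      + \<rho> * (snd (D i) - f0 (fst (D i)))\<^sup>2) / (2 * \<sigma>\<^sup>2))"

lemma nn_integral_excess_loss:
  assumes \<rho>: "0 < \<rho>" and fin: "L2_dist_sq p (nnet p k \<theta>) f0 = ennreal v" "0 \<le> v"
  shows "excess_loss k \<theta> \<rho> b n \<in> borel_measurable (data n)"
    and "(\<integral>\<^sup>+D. ennreal (excess_loss k \<theta> \<rho> b n D) \<partial>data n)
      = ennreal (n * (((1 + 1 / \<rho>) * (2 * v + 2 * b\<^sup>2) + \<rho> * \<sigma>\<^sup>2) / (2 * \<sigma>\<^sup>2)))"
proof -
  define a where "a = 1 + 1 / \<rho>"
  have a: "0 \<le> a"
    using \<rho> by (simp add: a_def)
  define c1 c2 c3 where "c1 = a * 2 / (2 * \<sigma>\<^sup>2)" and "c2 = a * (2 * b\<^sup>2) / (2 * \<sigma>\<^sup>2)" and "c3 = \<rho> / (2 * \<sigma>\<^sup>2)"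
  have c: "0 \<le> c1" "0 \<le> c2" "0 \<le> c3"
    using \<rho> a by (auto simp: c1_def c2_def c3_def)
  define g where "g z = c1 * (nnet p k \<theta> (fst z) - f0 (fst z))\<^sup>2 + c2 + c3 * (snd z - f0 (fst z))\<^sup>2" for z :: "(nat \<Rightarrow> real) \<times> real"
  have g0: "0 \<le> g z" for z
    using c by (simp add: g_def)
  have g_meas: "g \<in> borel_measurable obs"
    unfolding g_def[abs_def] by measurable
  have eq: "excess_loss k \<theta> \<rho> b n = (\<lambda>D. \<Sum>i<n. g (D i))"
    by (simp add: excess_loss_def[abs_def] a_def[symmetric] g_def c1_def c2_def c3_def add_divide_distrib distrib_left mult.assoc)
  show "excess_loss k \<theta> \<rho> b n \<in> borel_measurable (data n)"
    unfolding eq true_data_measure_def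
    using g_meas by (intro borel_measurable_sum measurable_compose[OF measurable_component_singleton]) auto
  have inner: "(\<integral>\<^sup>+y. ennreal (normal_density (f0 x) \<sigma> y) * ennreal (g (x, y)) \<partial>lborel)
      = ennreal c1 * ennreal ((nnet p k \<theta> x - f0 x)\<^sup>2) + ennreal (c2 + c3 * \<sigma>\<^sup>2)" for x
  proof -
    have "ennreal (normal_density (f0 x) \<sigma> y) * ennreal (g (x, y))
        = ennreal (c1 * (nnet p k \<theta> x - f0 x)\<^sup>2 + c2) * ennreal (normal_density (f0 x) \<sigma> y)
          + ennreal c3 * (ennreal (normal_density (f0 x) \<sigma> y) * ennreal ((y - f0 x)\<^sup>2))" for y
      using c by (simp add: g_def ennreal_mult'[symmetric] ennreal_plus[symmetric] algebra_simps del: ennreal_plus)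
    then have "(\<integral>\<^sup>+y. ennreal (normal_density (f0 x) \<sigma> y) * ennreal (g (x, y)) \<partial>lborel)
        = ennreal (c1 * (nnet p k \<theta> x - f0 x)\<^sup>2 + c2) * 1 + ennreal c3 * ennreal (\<sigma>\<^sup>2)"
      by (simp add: nn_integral_add nn_integral_cmult nn_integral_normal_density[OF \<sigma>] nn_integral_normal_density_square[OF \<sigma>])
    also have "\<dots> = ennreal c1 * ennreal ((nnet p k \<theta> x - f0 x)\<^sup>2) + ennreal (c2 + c3 * \<sigma>\<^sup>2)"
      using c by (simp add: ennreal_mult'[symmetric] ennreal_plus[symmetric] del: ennreal_plus)
    finally show ?thesis .
  qed
  have "(\<integral>\<^sup>+z. ennreal (g z) \<partial>obs)
      = (\<integral>\<^sup>+x. ennreal c1 * ennreal ((nnet p k \<theta> x - f0 x)\<^sup>2) + ennreal (c2 + c3 * \<sigma>\<^sup>2) \<partial>covariate_measure p)"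
    using g_meas by (subst nn_integral_obs) (auto simp: inner)
  also have "\<dots> = ennreal c1 * ennreal v + ennreal (c2 + c3 * \<sigma>\<^sup>2)"
    using fin by (subst nn_integral_add) (auto simp: nn_integral_cmult L2_dist_sq_def cov.emeasure_space_1)
  also have "\<dots> = ennreal (c1 * v + (c2 + c3 * \<sigma>\<^sup>2))"
    using c fin by (simp add: ennreal_mult'[symmetric])
  also have "c1 * v + (c2 + c3 * \<sigma>\<^sup>2) = ((1 + 1 / \<rho>) * (2 * v + 2 * b\<^sup>2) + \<rho> * \<sigma>\<^sup>2) / (2 * \<sigma>\<^sup>2)"
    by (simp add: a_def[symmetric] c1_def c2_def c3_def add_divide_distrib distrib_left mult.assoc)
  finally have single: "(\<integral>\<^sup>+z. ennreal (g z) \<partial>obs) = ennreal (((1 + 1 / \<rho>) * (2 * v + 2 * b\<^sup>2) + \<rho> * \<sigma>\<^sup>2) / (2 * \<sigma>\<^sup>2))" .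
  have "(\<integral>\<^sup>+D. ennreal (excess_loss k \<theta> \<rho> b n D) \<partial>data n) = (\<integral>\<^sup>+D. (\<Sum>i<n. ennreal (g (D i))) \<partial>data n)"
    unfolding eq using g0 by (simp add: sum_ennreal)
  also have "\<dots> = of_nat n * (\<integral>\<^sup>+z. ennreal (g z) \<partial>obs)"
    using g_meas by (intro nn_integral_data_sum) auto
  finally show "(\<integral>\<^sup>+D. ennreal (excess_loss k \<theta> \<rho> b n D) \<partial>data n)
      = ennreal (n * (((1 + 1 / \<rho>) * (2 * v + 2 * b\<^sup>2) + \<rho> * \<sigma>\<^sup>2) / (2 * \<sigma>\<^sup>2)))"
    by (simp only: single ennreal_mult'[OF of_nat_0_le_iff] ennreal_of_nat_eq_real_of_nat)
qed

text \<open>The regression error at a draw \<theta> splits into the error \<open>d\<close> of the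
  centre network and a perturbation \<open>e\<close>. By \<open>nnet_lipschitz\<close> and
  Cauchy-Schwarz, e^2 is at most (1 + B)^2 * K * S, where S is the squared distance to the centre;
  its mean K * t^2 produces the last parameter of \<open>excess_loss\<close>.\<close>

lemma variational_loss_le:
  fixes m :: "nat \<Rightarrow> real" and t B \<rho> :: real
  assumes \<zeta>: "0 < \<zeta>" and t: "0 < t" and \<rho>: "0 < \<rho>"
    and cube: "\<And>i. i < n \<Longrightarrow> fst (D i) \<in> unit_cube p"
    and B: "\<And>j. j < nparams p k \<Longrightarrow> \<bar>m j\<bar> \<le> B"
  shows "variational_loss \<zeta> k n D m (\<lambda>_. t) \<le> nparams p k * ln (\<zeta> / t)
      + (nparams p k * t\<^sup>2 + (\<Sum>i<nparams p k. (m i)\<^sup>2)) / (2 * \<zeta>\<^sup>2)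
      + excess_loss k m \<rho> ((1 + B) * nparams p k * t) n D"
proof -
  let ?K = "nparams p k"
  interpret mean_field ?K m "\<lambda>_. t"
    by unfold_locales (rule t)
  let ?\<pi> = "log_normal ?K (\<lambda>_. 0) (\<lambda>_. \<zeta>)" and ?q = "log_normal ?K m (\<lambda>_. t)"
  have B0: "0 \<le> B"
    using B[of 0] by (simp add: nparams_def)
  \<comment> \<open>The quadratic term of the log-density of q is nonpositive and is dropped. The
    log-normalisers differ by ln (\<zeta> / t) per coordinate.\<close>
  have prior_part: "?q \<theta> - ?\<pi> \<theta> \<le> ?K * ln (\<zeta> / t) + (\<Sum>i<?K. (\<theta> i)\<^sup>2) / (2 * \<zeta>\<^sup>2)" for \<theta>
  proof -
    have "?q \<theta> \<le> (\<Sum>i<?K. - ln (sqrt (2 * pi * t\<^sup>2)))"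
      unfolding log_normal_def by (intro sum_mono) simp
    moreover have "?\<pi> \<theta> = (\<Sum>i<?K. - ln (sqrt (2 * pi * \<zeta>\<^sup>2))) - (\<Sum>i<?K. (\<theta> i)\<^sup>2) / (2 * \<zeta>\<^sup>2)"
      by (simp add: log_normal_def sum_subtractf sum_divide_distrib)
    moreover have "ln (sqrt (2 * pi * u\<^sup>2)) = ln (sqrt (2 * pi)) + ln u" if "0 < u" for u
      using that by (simp add: real_sqrt_mult ln_mult)
    moreover have lnq: "ln (\<zeta> / t) = ln \<zeta> - ln t"
      using \<zeta> t by (simp add: ln_div)
    ultimately show ?thesis
      unfolding lnq using \<zeta> t by (simp add: algebra_simps)
  qed
  define d where "d i = nnet p k m (fst (D i)) - f0 (fst (D i))" for i
  define \<xi> where "\<xi> i = snd (D i) - f0 (fst (D i))" for i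
  define S where "S \<theta> = (\<Sum>i<?K. (\<theta> i - m i)\<^sup>2)" for \<theta>
  \<comment> \<open>The majorant is affine in \<open>S \<theta>\<close>, so the mean of S determines
    its integral exactly.\<close>
  define L where "L \<theta> = (\<Sum>i<n. ((1 + 1 / \<rho>) * (2 * (d i)\<^sup>2 + 2 * ((1 + B)\<^sup>2 * ?K * S \<theta>)) + \<rho> * (\<xi> i)\<^sup>2) / (2 * \<sigma>\<^sup>2))" for \<theta>
  have lik_part: "- log_ratio p k f0 \<sigma> n \<theta> D \<le> L \<theta>" for \<theta>
    unfolding log_ratio_def L_def sum_negf[symmetric]
  proof (rule sum_mono)
    fix i assume "i \<in> {..<n}"
    define e where "e = nnet p k \<theta> (fst (D i)) - nnet p k m (fst (D i))"
    have "\<bar>e\<bar> \<le> (1 + B) * (\<Sum>i<?K. \<bar>\<theta> i - m i\<bar>)"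
      unfolding e_def using cube[of i] B \<open>i \<in> {..<n}\<close> by (intro nnet_lipschitz) (auto simp: unit_cube_def)
    then have "e\<^sup>2 \<le> ((1 + B) * (\<Sum>i<?K. \<bar>\<theta> i - m i\<bar>))\<^sup>2"
      by (metis abs_ge_zero power2_abs power_mono)
    also have "\<dots> \<le> (1 + B)\<^sup>2 * (?K * S \<theta>)"
      using sum_squared_le_sum_of_squares[of "\<lambda>i. \<bar>\<theta> i - m i\<bar>" "{..<?K}"]
      by (simp add: power_mult_distrib S_def mult.commute mult_left_mono)
    finally have e2: "e\<^sup>2 \<le> (1 + B)\<^sup>2 * ?K * S \<theta>"
      by (simp add: mult.assoc)
    have "0 \<le> (d i - e)\<^sup>2"
      by simp
    then have sq: "(d i + e)\<^sup>2 \<le> 2 * (d i)\<^sup>2 + 2 * ((1 + B)\<^sup>2 * ?K * S \<theta>)"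
      using e2 by (simp add: power2_diff power2_sum)
    have young: "- 2 * \<xi> i * (d i + e) \<le> \<rho> * (\<xi> i)\<^sup>2 + (d i + e)\<^sup>2 / \<rho>"
    proof -
      have "0 \<le> (\<rho> * \<xi> i + (d i + e))\<^sup>2 / \<rho>"
        using \<rho> by simp
      then show ?thesis
        using \<rho> by (simp add: power2_sum add_divide_distrib power_mult_distrib) (simp add: power2_eq_square mult_ac)
    qed
    \<comment> \<open>The residual is \<open>\<xi> i\<close> at the truth and
      \<open>\<xi> i - (d i + e)\<close> at \<theta>.\<close>
    have "- ((snd (D i) - f0 (fst (D i)))\<^sup>2 - (snd (D i) - nnet p k \<theta> (fst (D i)))\<^sup>2)
        = (d i + e)\<^sup>2 + - 2 * \<xi> i * (d i + e)"
      by (simp add: d_def e_def \<xi>_def power2_eq_square algebra_simps)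
    also have "\<dots> \<le> (1 + 1 / \<rho>) * (d i + e)\<^sup>2 + \<rho> * (\<xi> i)\<^sup>2"
      using young by (simp add: distrib_right)
    also have "\<dots> \<le> (1 + 1 / \<rho>) * (2 * (d i)\<^sup>2 + 2 * ((1 + B)\<^sup>2 * ?K * S \<theta>)) + \<rho> * (\<xi> i)\<^sup>2"
      using \<rho> by (intro add_right_mono mult_left_mono sq) simp
    finally show "- (((snd (D i) - f0 (fst (D i)))\<^sup>2 - (snd (D i) - nnet p k \<theta> (fst (D i)))\<^sup>2) / (2 * \<sigma>\<^sup>2))
        \<le> ((1 + 1 / \<rho>) * (2 * (d i)\<^sup>2 + 2 * ((1 + B)\<^sup>2 * ?K * S \<theta>)) + \<rho> * (\<xi> i)\<^sup>2) / (2 * \<sigma>\<^sup>2)"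
      unfolding minus_divide_left using \<sigma> by (intro divide_right_mono) auto
  qed
  have S: "has_bochner_integral q S (?K * t\<^sup>2)"
    using has_bochner_integral_sum[of "{..<?K}" q "\<lambda>i \<theta>. (\<theta> i - m i)\<^sup>2" "\<lambda>_. t\<^sup>2"] centered_moment
    unfolding S_def[abs_def] by simp
  have sm: "has_bochner_integral q (\<lambda>\<theta>. \<Sum>i<?K. (\<theta> i)\<^sup>2) (?K * t\<^sup>2 + (\<Sum>i<?K. (m i)\<^sup>2))"
    using has_bochner_integral_sum[of "{..<?K}" q "\<lambda>i \<theta>. (\<theta> i)\<^sup>2" "\<lambda>i. t\<^sup>2 + (m i)\<^sup>2"] second_moment
    by (simp add: sum.distrib)
  have const: "has_bochner_integral q (\<lambda>_. c) c" for c :: real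
    by (simp add: has_bochner_integral_iff prob_space)
  have L: "has_bochner_integral q L (excess_loss k m \<rho> ((1 + B) * ?K * t) n D)"
  proof -
    have "has_bochner_integral q L (\<Sum>i<n. ((1 + 1 / \<rho>) * (2 * (d i)\<^sup>2 + 2 * ((1 + B)\<^sup>2 * ?K * (?K * t\<^sup>2))) + \<rho> * (\<xi> i)\<^sup>2) / (2 * \<sigma>\<^sup>2))"
      unfolding L_def[abs_def]
      by (intro has_bochner_integral_sum has_bochner_integral_divide has_bochner_integral_add
          has_bochner_integral_mult_right const S)
    moreover have "(1 + B)\<^sup>2 * ?K * (?K * t\<^sup>2) = ((1 + B) * ?K * t)\<^sup>2"
      by (simp add: power2_eq_square mult_ac)
    ultimately show ?thesis
      by (simp add: excess_loss_def d_def \<xi>_def)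
  qed
  have upper: "has_bochner_integral q (\<lambda>\<theta>. ?K * ln (\<zeta> / t) + (\<Sum>i<?K. (\<theta> i)\<^sup>2) / (2 * \<zeta>\<^sup>2) + L \<theta>)
     (?K * ln (\<zeta> / t) + (?K * t\<^sup>2 + (\<Sum>i<?K. (m i)\<^sup>2)) / (2 * \<zeta>\<^sup>2) + excess_loss k m \<rho> ((1 + B) * ?K * t) n D)"
    by (intro has_bochner_integral_divide has_bochner_integral_add const sm L)
  have "variational_loss \<zeta> k n D m (\<lambda>_. t) \<le> (\<integral>\<theta>. ?K * ln (\<zeta> / t) + (\<Sum>i<?K. (\<theta> i)\<^sup>2) / (2 * \<zeta>\<^sup>2) + L \<theta> \<partial>q)"
    unfolding variational_loss_def
  proof (rule integral_mono)
    show "integrable q (\<lambda>\<theta>. ?q \<theta> - ?\<pi> \<theta> - log_ratio p k f0 \<sigma> n \<theta> D)"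
      using integrable_log_normal integrable_log_ratio[OF mean_field_axioms]
      by (intro Bochner_Integration.integrable_diff) auto
    show "integrable q (\<lambda>\<theta>. ?K * ln (\<zeta> / t) + (\<Sum>i<?K. (\<theta> i)\<^sup>2) / (2 * \<zeta>\<^sup>2) + L \<theta>)"
      using upper by (simp add: has_bochner_integral_iff)
    show "?q \<theta> - ?\<pi> \<theta> - log_ratio p k f0 \<sigma> n \<theta> D \<le> ?K * ln (\<zeta> / t) + (\<Sum>i<?K. (\<theta> i)\<^sup>2) / (2 * \<zeta>\<^sup>2) + L \<theta>" for \<theta>
      using prior_part[of \<theta>] lik_part[of \<theta>] by linarith
  qed
  then show ?thesis
    using upper by (simp add: has_bochner_integral_iff)
qed

section \<open>Bound for a fixed sample size\<close>

text \<open>All tuning parameters stay free, which separates probability from asymptotics. The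
  exceptional set unites a large excess loss and a large evidence (Markov at levels w and M), the
  sieve event, and the null event of covariates off the cube. \<open>tail\<close> makes the mean of
  the weighted evidence at most 2, whence 2 / M.\<close>

lemma variational_posterior_bound:
  fixes \<theta>0 :: "nat \<Rightarrow> real" and k n :: nat and \<zeta> \<epsilon> t \<rho> v C h M w B \<tau> :: real
  defines "K \<equiv> nparams p k"
  defines "b \<equiv> (1 + B) * K * t"
  defines "F \<equiv> space (param_space K) - hellinger_nbhd p k f0 \<sigma> \<epsilon>"
  assumes \<zeta>: "0 < \<zeta>" and \<epsilon>: "0 < \<epsilon>" and t: "0 < t" and \<rho>: "0 < \<rho>" and C: "0 \<le> C" and M: "0 < M" and w: "0 < w"
    and \<tau>: "\<tau> = min (\<epsilon> / 8) (1 / 2)"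
    and h: "0 < h" "(1 + C) * (K * h) \<le> \<sigma> * sqrt (\<epsilon> * \<tau>) / 2"
    and v: "L2_dist_sq p (nnet p k \<theta>0) f0 = ennreal v" "0 \<le> v"
    and B: "\<And>j. j < K \<Longrightarrow> \<bar>\<theta>0 j\<bar> \<le> B"
    and tail: "exp (n * \<epsilon> / 8) * (K * (sqrt 2 * exp (- C\<^sup>2 / (4 * \<zeta>\<^sup>2)))) \<le> 1"
    and qs: "\<And>D. D \<in> space (data n) \<Longrightarrow> qs D \<in> mean_field_family K \<and>
        (\<forall>q \<in> mean_field_family K. dKL (qs D) (posterior p k \<sigma> \<zeta> n D) \<le> dKL q (posterior p k \<sigma> \<zeta> n D))"
  obtains E where "E \<in> sets (data n)"
    "measure (data n) E \<le> n * (((1 + 1 / \<rho>) * (2 * v + 2 * b\<^sup>2) + \<rho> * \<sigma>\<^sup>2) / (2 * \<sigma>\<^sup>2)) / w + 2 / M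
      + (2 * C / h + 3) ^ K * exp (- (n * \<epsilon> / 16))"
    "\<And>D. D \<in> space (data n) - E \<Longrightarrow> n * \<epsilon> / 8 * measure (qs D) F
      \<le> K * ln (\<zeta> / t) + (K * t\<^sup>2 + (\<Sum>i<K. (\<theta>0 i)\<^sup>2)) / (2 * \<zeta>\<^sup>2) + w + ln (M + 1)"
proof -
  interpret data: prob_space "data n"
    by (rule prob_space_data)
  define pr where "pr = normal_prior \<zeta> K"
  define c where "c = n * \<epsilon> / 8"
  define R where "R = {\<theta> \<in> space pr. \<exists>i<K. C < \<bar>\<theta> i\<bar>}"
  define Z where "Z D = (\<integral>\<^sup>+\<theta>. ennreal (exp (log_ratio p k f0 \<sigma> n \<theta> D)) * (1 + ennreal (exp c) * indicator R \<theta>) \<partial>pr)" for D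
  define W where "W = excess_loss k \<theta>0 \<rho> b n"
  define EW where "EW = n * (((1 + 1 / \<rho>) * (2 * v + 2 * b\<^sup>2) + \<rho> * \<sigma>\<^sup>2) / (2 * \<sigma>\<^sup>2))"
  have Z_meas [measurable]: "Z \<in> borel_measurable (data n)"
    unfolding Z_def R_def pr_def K_def by (rule expected_evidence(1)[OF \<zeta> C]) simp
  have "(\<integral>\<^sup>+D. Z D \<partial>data n) \<le> ennreal (1 + exp c * (K * (sqrt 2 * exp (- C\<^sup>2 / (4 * \<zeta>\<^sup>2)))))"
    unfolding Z_def R_def pr_def K_def by (rule expected_evidence(2)[OF \<zeta> C]) simp
  also have "\<dots> \<le> ennreal 2"
    using tail by (intro ennreal_leI) (simp add: c_def)
  finally have EZ: "(\<integral>\<^sup>+D. Z D \<partial>data n) \<le> ennreal 2" .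
  have W_meas [measurable]: "W \<in> borel_measurable (data n)"
    unfolding W_def by (rule nn_integral_excess_loss(1)[OF \<rho> v])
  have EW: "(\<integral>\<^sup>+D. ennreal (W D) \<partial>data n) = ennreal EW"
    unfolding W_def EW_def by (rule nn_integral_excess_loss(2)[OF \<rho> v])
  have EW0: "0 \<le> EW"
    using \<rho> v by (simp add: EW_def)
  have markov: "emeasure (data n) {D \<in> space (data n). 1 \<le> ennreal (1 / u) * g D} \<le> ennreal (e / u)"
    if [measurable]: "g \<in> borel_measurable (data n)" and "(\<integral>\<^sup>+D. g D \<partial>data n) \<le> ennreal e" "0 < u" for g u e
  proof -
    have "emeasure (data n) {D \<in> space (data n). 1 \<le> ennreal (1 / u) * g D}
        \<le> ennreal (1 / u) * (\<integral>\<^sup>+D. g D * indicator (space (data n)) D \<partial>data n)"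
      by (rule nn_integral_Markov_inequality) auto
    also have "(\<integral>\<^sup>+D. g D * indicator (space (data n)) D \<partial>data n) = (\<integral>\<^sup>+D. g D \<partial>data n)"
      by (intro nn_integral_cong) auto
    also have "ennreal (1 / u) * \<dots> \<le> ennreal (1 / u) * ennreal e"
      by (intro mult_left_mono that) simp
    also have "\<dots> = ennreal (e / u)"
      using that by (simp add: ennreal_mult'[symmetric])
    finally show ?thesis .
  qed
  define E1 where "E1 = {D \<in> space (data n). 1 \<le> ennreal (1 / w) * ennreal (W D)}"
  define E2 where "E2 = {D \<in> space (data n). 1 \<le> ennreal (1 / M) * Z D}"
  have E1: "E1 \<in> sets (data n)" "emeasure (data n) E1 \<le> ennreal (EW / w)"
    unfolding E1_def by (measurable, rule markov[OF _ _ w]) (auto simp: EW)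
  have E2: "E2 \<in> sets (data n)" "emeasure (data n) E2 \<le> ennreal (2 / M)"
    unfolding E2_def by (measurable, rule markov[OF Z_meas EZ M])
  obtain E3 where E3: "E3 \<in> sets (data n)"
    "emeasure (data n) E3 \<le> ennreal ((2 * C / h + 3) ^ K * exp (- (n * \<epsilon> / 16)))"
    "\<And>D \<theta>. D \<in> space (data n) - E3 \<Longrightarrow> (\<And>i. i < n \<Longrightarrow> fst (D i) \<in> unit_cube p) \<Longrightarrow>
      (\<And>i. i < K \<Longrightarrow> \<bar>\<theta> i\<bar> \<le> C) \<Longrightarrow> \<epsilon> \<le> hellinger p k f0 \<sigma> \<theta> \<Longrightarrow>
      log_ratio p k f0 \<sigma> n \<theta> D \<le> - (n * \<epsilon> / 8)"
    unfolding K_def using sieve_event[OF \<epsilon> \<tau> refl C h(1) h(2)[unfolded K_def], of n] by metis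
  obtain E4 where E4: "E4 \<in> null_sets (data n)"
    "\<And>D. D \<in> space (data n) - E4 \<Longrightarrow> \<forall>i<n. fst (D i) \<in> unit_cube p"
    using AE_E3[OF AE_data_unit_cube[of n]] by blast
  define E where "E = E1 \<union> E2 \<union> E3 \<union> E4"
  have E4': "E4 \<in> sets (data n)" "emeasure (data n) E4 = 0"
    using E4(1) by auto
  show thesis
  proof
    show "E \<in> sets (data n)"
      unfolding E_def using E1(1) E2(1) E3(1) E4' by auto
    have "emeasure (data n) E \<le> emeasure (data n) E1 + emeasure (data n) E2 + emeasure (data n) E3 + emeasure (data n) E4"
      unfolding E_def using E1(1) E2(1) E3(1) E4'(1)
      by (intro order_trans[OF emeasure_subadditive] add_mono order_refl) auto
    also have "\<dots> \<le> ennreal (EW / w) + ennreal (2 / M) + ennreal ((2 * C / h + 3) ^ K * exp (- (n * \<epsilon> / 16))) + 0"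
      using E1(2) E2(2) E3(2) E4'(2) by (intro add_mono) auto
    also have "\<dots> = ennreal (EW / w + 2 / M + (2 * C / h + 3) ^ K * exp (- (n * \<epsilon> / 16)))"
      using EW0 w M C h(1) by (simp add: ennreal_plus[symmetric] del: ennreal_plus)
    finally show "measure (data n) E \<le> n * (((1 + 1 / \<rho>) * (2 * v + 2 * b\<^sup>2) + \<rho> * \<sigma>\<^sup>2) / (2 * \<sigma>\<^sup>2)) / w + 2 / M
        + (2 * C / h + 3) ^ K * exp (- (n * \<epsilon> / 16))"
      unfolding EW_def[symmetric] using EW0 w M C h(1)
      by (subst (asm) data.emeasure_eq_measure) (subst (asm) ennreal_le_iff, auto)
    fix D assume D: "D \<in> space (data n) - E"
    then have Ds: "D \<in> space (data n)" and nE: "D \<notin> E1" "D \<notin> E2" "D \<notin> E3" "D \<notin> E4"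
      by (auto simp: E_def)
    have cube: "fst (D i) \<in> unit_cube p" if "i < n" for i
      using E4(2)[of D] Ds nE that by auto
    have "ennreal (1 / w) * ennreal (W D) < 1"
      using nE(1) Ds by (auto simp: E1_def not_le)
    then have "1 / w * W D < 1"
      using w by (simp only: ennreal_mult'[symmetric] ennreal_less_one_iff divide_nonneg_pos zero_le_one)
    then have W_le: "W D \<le> w"
      using w by (simp add: field_simps)
    have "ennreal (1 / M) * Z D < 1"
      using nE(2) Ds by (auto simp: E2_def not_le)
    then have "ennreal M * (ennreal (1 / M) * Z D) \<le> ennreal M * 1"
      by (intro mult_left_mono) auto
    then have Z_le: "Z D \<le> ennreal M"
      using M by (simp add: mult.assoc[symmetric] ennreal_mult'[symmetric])
    \<comment> \<open>\<open>measure\<close> is \<open>0\<close> on nonmeasurable sets, so \<open>F\<close> and \<open>A\<close> have the same measure.\<close>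
    define A where "A = (if F \<in> sets (PiM {..<K} (\<lambda>_. borel)) then F else {})"
    have A: "A \<in> sets (PiM {..<K} (\<lambda>_. borel))"
      by (simp add: A_def)
    have pr_space: "space pr = space (param_space K)" "prob_space pr"
      unfolding pr_def param_space_def
      by (auto intro!: sets_eq_imp_space_eq prob_space_normal_prior \<zeta> simp: sets_normal_prior sets_PiM_lborel)
    have "(\<integral>\<^sup>+\<theta>. ennreal (exp (c * indicator A \<theta> + log_ratio p k f0 \<sigma> n \<theta> D)) \<partial>pr) \<le> (\<integral>\<^sup>+\<theta>. ennreal (exp (log_ratio p k f0 \<sigma> n \<theta> D)) * (1 + ennreal (exp c) * indicator R \<theta>) + 1 \<partial>pr)"
    proof (rule nn_integral_mono)
      fix \<theta> assume \<theta>: "\<theta> \<in> space pr"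
      let ?l = "log_ratio p k f0 \<sigma> n \<theta> D"
      \<comment> \<open>Off A there is no tilt; on R the weight exp c absorbs it; on the rest of A
        the sieve bound cancels it and leaves at most 1. The last case explains the added 1 in the
        integrand and later the M + 1.\<close>
      consider "\<theta> \<notin> A" | "\<theta> \<in> A" "\<theta> \<in> R" | "\<theta> \<in> A" "\<theta> \<notin> R"
        by blast
      then show "ennreal (exp (c * indicator A \<theta> + ?l)) \<le> ennreal (exp ?l) * (1 + ennreal (exp c) * indicator R \<theta>) + 1"
      proof cases
        case 1
        then show ?thesis
          by (auto simp: distrib_left add.assoc intro!: add_increasing2)
      next
        case 2
        then have "ennreal (exp (c * indicator A \<theta> + ?l)) = ennreal (exp ?l) * ennreal (exp c)"
          by (simp add: ennreal_mult'[symmetric] mult_exp_exp add.commute)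
        also have "\<dots> \<le> ennreal (exp ?l) + ennreal (exp ?l) * ennreal (exp c) + 1"
          by (simp add: add.commute add.left_commute add_increasing2)
        finally show ?thesis
          using 2 by (simp add: distrib_left)
      next
        case 3
        then have "\<theta> \<in> F"
          by (auto simp: A_def split: if_splits)
        then have "\<epsilon> \<le> hellinger p k f0 \<sigma> \<theta>"
          by (auto simp: F_def hellinger_nbhd_def K_def)
        moreover have "\<bar>\<theta> i\<bar> \<le> C" if "i < K" for i
        proof (rule ccontr)
          assume "\<not> \<bar>\<theta> i\<bar> \<le> C"
          then have "\<theta> \<in> R"
            unfolding R_def using \<theta> that by (auto simp: not_le)
          with 3 show False
            by blast
        qed
        ultimately have "?l \<le> - (n * \<epsilon> / 8)"
          using Ds nE(3) cube by (intro E3(3)) auto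
        then have "ennreal (exp (c * indicator A \<theta> + ?l)) \<le> ennreal 1"
          using 3 by (intro ennreal_leI) (simp add: c_def)
        also have "\<dots> \<le> ennreal (exp ?l) * (1 + ennreal (exp c) * indicator R \<theta>) + 1"
          by (simp add: add_increasing)
        finally show ?thesis .
      qed
    qed
    also have "\<dots> = Z D + 1"
    proof -
      have "(\<lambda>\<theta>. ennreal (exp (log_ratio p k f0 \<sigma> n \<theta> D)) * (1 + ennreal (exp c) * indicator R \<theta>)) \<in> borel_measurable pr"
        unfolding pr_def R_def K_def by measurable
      then show ?thesis
        using prob_space.emeasure_space_1[OF pr_space(2)] by (subst nn_integral_add) (auto simp: Z_def)
    qed
    also have "\<dots> \<le> ennreal (M + 1)"
      using Z_le M by (simp add: add_right_mono)
    finally have evid: "(\<integral>\<^sup>+\<theta>. ennreal (exp (c * indicator A \<theta> + log_ratio p k f0 \<sigma> n \<theta> D)) \<partial>pr) \<le> ennreal (M + 1)" .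
    obtain m s where ms: "qs D = mean_field_normal K m s" "\<And>i. i < K \<Longrightarrow> 0 < s i"
      using qs[OF Ds] unfolding mean_field_family_eq by auto
    have mf: "mean_field (nparams p k) s" "mean_field (nparams p k) (\<lambda>_. t)"
      using ms(2) t by (auto simp: mean_field_def K_def)
    have "mean_field_normal K \<theta>0 (\<lambda>_. t) \<in> mean_field_family K"
      using t unfolding mean_field_family_eq by blast
    then have "dKL (mean_field_normal K m s) (posterior p k \<sigma> \<zeta> n D)
        \<le> dKL (mean_field_normal K \<theta>0 (\<lambda>_. t)) (posterior p k \<sigma> \<zeta> n D)"
      using qs[OF Ds] ms(1) by auto
    then have opt: "variational_loss \<zeta> k n D m s \<le> variational_loss \<zeta> k n D \<theta>0 (\<lambda>_. t)"
      unfolding K_def dKL_posterior[OF \<zeta> mf(1)] dKL_posterior[OF \<zeta> mf(2)] by simp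
    have "c * measure (qs D) F = c * measure (mean_field_normal K m s) A"
      by (simp add: ms(1) A_def measure_notin_sets)
    also have "\<dots> \<le> variational_loss \<zeta> k n D m s + ln (M + 1)"
      using A evid M unfolding K_def pr_def by (intro variational_loss_ge \<zeta> mf) auto
    also have "\<dots> \<le> variational_loss \<zeta> k n D \<theta>0 (\<lambda>_. t) + ln (M + 1)"
      using opt by simp
    also have "\<dots> \<le> K * ln (\<zeta> / t) + (K * t\<^sup>2 + (\<Sum>i<K. (\<theta>0 i)\<^sup>2)) / (2 * \<zeta>\<^sup>2) + W D + ln (M + 1)"
      using variational_loss_le[OF \<zeta> t \<rho> cube B[unfolded K_def]] by (simp add: W_def b_def K_def)
    also have "\<dots> \<le> K * ln (\<zeta> / t) + (K * t\<^sup>2 + (\<Sum>i<K. (\<theta>0 i)\<^sup>2)) / (2 * \<zeta>\<^sup>2) + w + ln (M + 1)"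
      using W_le by simp
    finally show "n * \<epsilon> / 8 * measure (qs D) F \<le> \<dots>"
      by (simp add: c_def)
  qed
qed

end

section \<open>Rates\<close>

text \<open>Nothing makes the choice of the minimiser measurable in the data, so the set of bad data
  is covered by a measurable exceptional set instead of being measured itself.\<close>

lemma outer_prob_le:
  assumes "B \<in> sets M" "A \<subseteq> B"
  shows "outer_prob M A \<le> measure M B"
  unfolding outer_prob_def using assms by (intro cInf_lower bdd_belowI[of _ 0]) auto

text \<open>Inclusion in the space supplies a cover; otherwise the infimum could be over the empty
  set.\<close>

lemma outer_prob_nonneg:
  assumes "A \<subseteq> space M"
  shows "0 \<le> outer_prob M A"
  unfolding outer_prob_def using assms by (intro cInf_greatest) auto

lemma nparams_bigo:
  assumes kn: "(\<lambda>n. real (k n)) \<sim>[at_top] (\<lambda>n. real n powr a)" and a: "0 < a"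
  obtains c where "0 < c" "\<forall>\<^sub>F n in at_top. real (nparams p (k n)) \<le> c * real n powr a"
proof -
  from asymp_equiv_imp_bigo[OF kn] obtain c where c: "0 < c"
    "\<forall>\<^sub>F n in at_top. norm (real (k n)) \<le> c * norm (real n powr a)"
    by (rule landau_o.bigE)
  have "\<forall>\<^sub>F n in at_top. real (nparams p (k n)) \<le> (1 + c * (p + 1)) * real n powr a"
    using c(2) eventually_ge_at_top[of 1]
  proof eventually_elim
    case (elim n)
    have "real (k n) * (p + 1) \<le> c * real n powr a * (p + 1)"
      using elim(1) by (intro mult_right_mono) auto
    moreover have "1 \<le> real n powr a"
      using elim(2) a by (intro ge_one_powr_ge_zero) auto
    ultimately show ?case
      by (simp add: nparams_def algebra_simps)
  qed
  moreover have "0 < 1 + c * (p + 1)"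
    using c(1) by (simp add: add_pos_nonneg)
  ultimately show thesis
    by (intro that)
qed

text \<open>The logarithmic term is of order n powr a * ln n and needs \<delta> < 1 - a, not merely
  \<delta> < 1. The budget e is shared in thirds by the logarithms, the variances and the
  coefficients.\<close>

lemma rate_bound_loss:
  fixes K :: "nat \<Rightarrow> real" and S :: "nat \<Rightarrow> real"
  assumes a: "0 < a" and \<delta>: "0 \<le> \<delta>" "\<delta> < 1 - a" and \<zeta>: "0 < \<zeta>" and c: "0 < c" and e: "0 < e"
    and K: "\<forall>\<^sub>F n in at_top. K n \<le> c * real n powr a" "\<And>n. 0 \<le> K n"
    and S: "S \<in> o(\<lambda>n. real n powr (1 - \<delta>))"
  shows "\<forall>\<^sub>F n in at_top. K n * ln (\<zeta> / (1 / real n ^ 4)) + (K n * (1 / real n ^ 4)\<^sup>2 + S n) / (2 * \<zeta>\<^sup>2)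
      \<le> e * real n powr (1 - \<delta>)"
proof -
  have 1: "\<forall>\<^sub>F n in at_top. c * real n powr a * ln (\<zeta> * real n ^ 4) \<le> e / 3 * real n powr (1 - \<delta>)"
    using a \<delta> \<zeta> c e by real_asymp
  \<comment> \<open>The sign of the logarithm is needed before \<open>K n\<close> may be replaced by
    its upper bound.\<close>
  have 2: "\<forall>\<^sub>F n in at_top. 0 \<le> ln (\<zeta> * real n ^ 4)"
    using \<zeta> by real_asymp
  have 3: "\<forall>\<^sub>F n in at_top. c * real n powr a * (1 / real n ^ 4)\<^sup>2 / (2 * \<zeta>\<^sup>2) \<le> e / 3 * real n powr (1 - \<delta>)"
    using a \<delta> \<zeta> c e by real_asymp
  have 4: "\<forall>\<^sub>F n in at_top. norm (S n) \<le> (e / 3 * (2 * \<zeta>\<^sup>2)) * norm (real n powr (1 - \<delta>))"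
    using \<zeta> e by (intro landau_o.smallD[OF S]) auto
  from 1 2 3 4 K(1) eventually_gt_at_top[of 0] show ?thesis
  proof eventually_elim
    case (elim n)
    have "K n * ln (\<zeta> * real n ^ 4) \<le> c * real n powr a * ln (\<zeta> * real n ^ 4)"
      using elim by (intro mult_right_mono) auto
    moreover have "K n * (1 / real n ^ 4)\<^sup>2 / (2 * \<zeta>\<^sup>2) \<le> c * real n powr a * (1 / real n ^ 4)\<^sup>2 / (2 * \<zeta>\<^sup>2)"
      using elim by (intro divide_right_mono mult_right_mono) auto
    moreover have "S n / (2 * \<zeta>\<^sup>2) \<le> e / 3 * real n powr (1 - \<delta>)"
      using elim(4) \<zeta> by (simp add: field_simps)
    ultimately show ?case
      using elim(1,3) by (simp add: add_divide_distrib)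
  qed
qed

text \<open>With a box of radius n the prior tail decays like exp (- const * n^2), which beats a
  tilt that is exponential in n.\<close>

lemma rate_tail:
  fixes K :: "nat \<Rightarrow> real"
  assumes \<zeta>: "0 < \<zeta>" and \<epsilon>: "0 < \<epsilon>" and K: "\<forall>\<^sub>F n in at_top. K n \<le> real n"
  shows "\<forall>\<^sub>F n in at_top. exp (real n * \<epsilon> / 8) * (K n * (sqrt 2 * exp (- (real n)\<^sup>2 / (4 * \<zeta>\<^sup>2)))) \<le> 1"
proof -
  have "\<forall>\<^sub>F n in at_top. exp (real n * \<epsilon> / 8) * (real n * (sqrt 2 * exp (- (real n)\<^sup>2 / (4 * \<zeta>\<^sup>2)))) \<le> 1"
    using \<zeta> \<epsilon> by real_asymp
  with K show ?thesis
  proof eventually_elim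
    case (elim n)
    have "exp (real n * \<epsilon> / 8) * (K n * (sqrt 2 * exp (- (real n)\<^sup>2 / (4 * \<zeta>\<^sup>2))))
        \<le> exp (real n * \<epsilon> / 8) * (real n * (sqrt 2 * exp (- (real n)\<^sup>2 / (4 * \<zeta>\<^sup>2))))"
      using elim(1) by (intro mult_left_mono mult_right_mono) auto
    with elim(2) show ?case
      by linarith
  qed
qed

text \<open>The number of cells per coordinate is cubic in n, hence eventually at most n^4. The
  logarithm of the covering number is then O(n powr a * ln n), which is o(n) since a < 1.\<close>

lemma rate_entropy:
  fixes K :: "nat \<Rightarrow> nat" and a c \<eta> \<epsilon> :: real
  assumes a: "0 < a" "a < 1" and c: "0 < c" and \<eta>: "0 < \<eta>" and \<epsilon>: "0 < \<epsilon>"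
    and K: "\<forall>\<^sub>F n in at_top. real (K n) \<le> c * real n powr a" "\<forall>\<^sub>F n in at_top. real (K n) \<le> real n" "\<And>n. 0 < K n"
  shows "(\<lambda>n. (2 * real n / (\<eta> / ((1 + real n) * real (K n))) + 3) ^ K n * exp (- (real n * \<epsilon> / 16))) \<longlonglongrightarrow> 0"
proof (rule tendsto_sandwich[OF _ _ tendsto_const])
  show "(\<lambda>n. exp (c * real n powr a * (4 * ln (real n)) - real n * \<epsilon> / 16)) \<longlonglongrightarrow> 0"
    using a c \<epsilon> by real_asymp
  show "\<forall>\<^sub>F n in at_top. 0 \<le> (2 * real n / (\<eta> / ((1 + real n) * real (K n))) + 3) ^ K n * exp (- (real n * \<epsilon> / 16))"
    using \<eta> by (intro always_eventually allI mult_nonneg_nonneg zero_le_power) auto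
  have "\<forall>\<^sub>F n in at_top. 2 * real n * ((1 + real n) * real n) / \<eta> + 3 \<le> real n ^ 4"
    using \<eta> by real_asymp
  with K(1,2) eventually_gt_at_top[of 1]
  show "\<forall>\<^sub>F n in at_top. (2 * real n / (\<eta> / ((1 + real n) * real (K n))) + 3) ^ K n * exp (- (real n * \<epsilon> / 16))
      \<le> exp (c * real n powr a * (4 * ln (real n)) - real n * \<epsilon> / 16)"
  proof eventually_elim
    case (elim n)
    have "2 * real n / (\<eta> / ((1 + real n) * real (K n))) + 3 = 2 * real n * ((1 + real n) * real (K n)) / \<eta> + 3"
      by simp
    also have "\<dots> \<le> 2 * real n * ((1 + real n) * real n) / \<eta> + 3"
      using elim(2) \<eta> by (intro add_right_mono divide_right_mono mult_left_mono) auto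
    also have "\<dots> \<le> real n ^ 4"
      by (rule elim)
    also have "\<dots> = exp (4 * ln (real n))"
      using elim(3) exp_of_nat_mult[of 4 "ln (real n)"] by simp
    finally have "(2 * real n / (\<eta> / ((1 + real n) * real (K n))) + 3) ^ K n \<le> exp (4 * ln (real n)) ^ K n"
      using \<eta> by (intro power_mono) auto
    also have "\<dots> = exp (real (K n) * (4 * ln (real n)))"
      by (simp add: exp_of_nat_mult)
    also have "\<dots> \<le> exp (c * real n powr a * (4 * ln (real n)))"
      unfolding exp_le_cancel_iff using elim(1,3) by (intro mult_right_mono) auto
    finally have "(2 * real n / (\<eta> / ((1 + real n) * real (K n))) + 3) ^ K n * exp (- (real n * \<epsilon> / 16))
        \<le> exp (c * real n powr a * (4 * ln (real n))) * exp (- (real n * \<epsilon> / 16))"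
      by (rule mult_right_mono) simp
    then show ?case
      by (simp add: mult_exp_exp)
  qed
qed

text \<open>Young's inequality costs v / \<rho> on one side and \<rho> * \<sigma>^2 on the other, so
  \<rho> should be of order sqrt v. The summand 1 / n keeps it positive when v = 0 and makes it
  dominate b. Everything is then at most a constant times n * \<rho>, and \<rho> is o(n powr (-
  \<delta>)).\<close>

lemma rate_excess:
  fixes v b \<rho> :: "nat \<Rightarrow> real"
  assumes \<delta>: "0 \<le> \<delta>" "\<delta> < 1" and \<sigma>: "0 < \<sigma>" and e: "0 < e"
    and v: "\<And>n. 0 \<le> v n" "(\<lambda>n. sqrt (v n)) \<in> o(\<lambda>n. real n powr (- \<delta>))"
    and \<rho>: "\<And>n. \<rho> n = sqrt (v n) + 1 / real n"
    and b: "\<forall>\<^sub>F n in at_top. 0 \<le> b n \<and> b n \<le> 1 / real n"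
  shows "(\<lambda>n. real n * (((1 + 1 / \<rho> n) * (2 * v n + 2 * (b n)\<^sup>2) + \<rho> n * \<sigma>\<^sup>2) / (2 * \<sigma>\<^sup>2)) / (e * real n powr (1 - \<delta>)))
    \<longlonglongrightarrow> 0"
proof (rule tendsto_sandwich[OF _ _ tendsto_const])
  have "(\<lambda>n. 1 / real n) \<in> o(\<lambda>n. real n powr (- \<delta>))"
    using \<delta> by real_asymp
  then have \<rho>_o: "\<rho> \<in> o(\<lambda>n. real n powr (- \<delta>))"
    unfolding \<rho>[abs_def] using v(2) by (rule sum_in_smallo(1)[rotated])
  then have lim: "(\<lambda>n. \<rho> n / real n powr (- \<delta>)) \<longlonglongrightarrow> 0"
    by (rule smalloD_tendsto)
  show "(\<lambda>n. (8 + \<sigma>\<^sup>2) / (2 * \<sigma>\<^sup>2 * e) * (\<rho> n / real n powr (- \<delta>))) \<longlonglongrightarrow> 0"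
    using tendsto_mult_right_zero[OF lim] .
  show "\<forall>\<^sub>F n in at_top. 0 \<le> real n * (((1 + 1 / \<rho> n) * (2 * v n + 2 * (b n)\<^sup>2) + \<rho> n * \<sigma>\<^sup>2) / (2 * \<sigma>\<^sup>2)) / (e * real n powr (1 - \<delta>))"
    using v(1) e by (intro always_eventually allI) (auto simp: \<rho>)
  have "\<forall>\<^sub>F n in at_top. norm (\<rho> n) \<le> 1 * norm (real n powr (- \<delta>))"
    using landau_o.smallD[OF \<rho>_o, of 1] by simp
  with b eventually_ge_at_top[of 1]
  show "\<forall>\<^sub>F n in at_top. real n * (((1 + 1 / \<rho> n) * (2 * v n + 2 * (b n)\<^sup>2) + \<rho> n * \<sigma>\<^sup>2) / (2 * \<sigma>\<^sup>2)) / (e * real n powr (1 - \<delta>))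
      \<le> (8 + \<sigma>\<^sup>2) / (2 * \<sigma>\<^sup>2 * e) * (\<rho> n / real n powr (- \<delta>))"
  proof eventually_elim
    case (elim n)
    have pos: "0 < \<rho> n"
      using elim(2) v(1)[of n] by (auto simp: \<rho> intro!: add_nonneg_pos)
    have "real n powr (- \<delta>) \<le> 1"
      using elim(2) \<delta> by (simp add: powr_minus_divide ge_one_powr_ge_zero)
    then have le1: "\<rho> n \<le> 1"
      using elim(3) by simp
    have "v n = (sqrt (v n))\<^sup>2"
      using v(1) by simp
    also have "\<dots> \<le> (\<rho> n)\<^sup>2"
      using v(1)[of n] by (intro power_mono) (auto simp: \<rho>)
    finally have v_le: "v n \<le> (\<rho> n)\<^sup>2" .
    have "(b n)\<^sup>2 \<le> (\<rho> n)\<^sup>2"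
      using elim(1) v(1)[of n] by (intro power_mono) (auto simp: \<rho> add_increasing)
    then have "(1 + 1 / \<rho> n) * (2 * v n + 2 * (b n)\<^sup>2) \<le> (1 + 1 / \<rho> n) * (4 * (\<rho> n)\<^sup>2)"
      using v_le pos by (intro mult_left_mono) auto
    also have "\<dots> = \<rho> n * (4 * \<rho> n + 4)"
      using pos by (simp add: power2_eq_square field_simps)
    also have "\<dots> \<le> \<rho> n * 8"
      using le1 pos by (intro mult_left_mono) auto
    finally have "(1 + 1 / \<rho> n) * (2 * v n + 2 * (b n)\<^sup>2) + \<rho> n * \<sigma>\<^sup>2 \<le> \<rho> n * (8 + \<sigma>\<^sup>2)"
      by (simp add: distrib_left)
    then have "real n * (((1 + 1 / \<rho> n) * (2 * v n + 2 * (b n)\<^sup>2) + \<rho> n * \<sigma>\<^sup>2) / (2 * \<sigma>\<^sup>2)) / (e * real n powr (1 - \<delta>))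
        \<le> real n * (\<rho> n * (8 + \<sigma>\<^sup>2) / (2 * \<sigma>\<^sup>2)) / (e * real n powr (1 - \<delta>))"
      using e by (intro divide_right_mono mult_left_mono) auto
    also have pw: "real n powr (1 - \<delta>) = real n * real n powr (- \<delta>)"
      using elim(2) by (simp add: powr_diff powr_minus_divide)
    also have "real n * (\<rho> n * (8 + \<sigma>\<^sup>2) / (2 * \<sigma>\<^sup>2)) / (e * (real n * real n powr (- \<delta>)))
        = (8 + \<sigma>\<^sup>2) / (2 * \<sigma>\<^sup>2 * e) * (\<rho> n / real n powr (- \<delta>))"
      using elim(2) by (simp add: mult_ac)
    finally show ?case
      unfolding pw .
  qed
qed

theorem theorem1:
  fixes p :: nat and k :: "nat \<Rightarrow> nat" and a \<delta> \<sigma>0 \<zeta> \<epsilon> :: real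
    and f0 :: "(nat \<Rightarrow> real) \<Rightarrow> real"
    and qstar :: "nat \<Rightarrow> (nat \<Rightarrow> (nat \<Rightarrow> real) \<times> real) \<Rightarrow> (nat \<Rightarrow> real) measure"
  assumes a: "0 < a" "a < 1"
    and kn: "(\<lambda>n. real (k n)) \<sim>[at_top] (\<lambda>n. real n powr a)"
    and \<delta>: "0 \<le> \<delta>" "\<delta> < 1 - a"
    and \<sigma>0: "0 < \<sigma>0" and \<zeta>: "0 < \<zeta>"
    and f0_meas: "f0 \<in> borel_measurable (covariate_measure p)"
    and A12: "\<exists>\<theta>0 :: nat \<Rightarrow> nat \<Rightarrow> real.
        (\<forall>\<^sub>F n in at_top. L2_dist_sq p (nnet p (k n) (\<theta>0 n)) f0 < \<infinity>) \<and>
        (\<lambda>n. sqrt (enn2real (L2_dist_sq p (nnet p (k n) (\<theta>0 n)) f0))) \<in> o(\<lambda>n. real n powr (- \<delta>)) \<and>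
        (\<lambda>n. \<Sum>i<nparams p (k n). (\<theta>0 n i)\<^sup>2) \<in> o(\<lambda>n. real n powr (1 - \<delta>))"
    and qstar: "\<And>n D. D \<in> space (true_data_measure p f0 \<sigma>0 n) \<Longrightarrow>
        qstar n D \<in> mean_field_family (nparams p (k n)) \<and>
        (\<forall>q \<in> mean_field_family (nparams p (k n)).
           dKL (qstar n D) (posterior p (k n) \<sigma>0 \<zeta> n D) \<le> dKL q (posterior p (k n) \<sigma>0 \<zeta> n D))"
    and \<epsilon>: "0 < \<epsilon>"
  shows "little_o_prob (true_data_measure p f0 \<sigma>0)
           (\<lambda>n D. measure (qstar n D)
              (space (param_space (nparams p (k n))) - hellinger_nbhd p (k n) f0 \<sigma>0 \<epsilon>))
           (\<lambda>n. real n powr (- \<delta>))"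
proof -
  define K where "K n = nparams p (k n)" for n
  interpret nnet_regression p f0 \<sigma>0
    by unfold_locales (fact f0_meas, fact \<sigma>0)
  obtain \<theta>0 where fin: "\<forall>\<^sub>F n in at_top. L2_dist_sq p (nnet p (k n) (\<theta>0 n)) f0 < \<infinity>"
    and approx: "(\<lambda>n. sqrt (enn2real (L2_dist_sq p (nnet p (k n) (\<theta>0 n)) f0))) \<in> o(\<lambda>n. real n powr (- \<delta>))"
    and coeff: "(\<lambda>n. \<Sum>i<nparams p (k n). (\<theta>0 n i)\<^sup>2) \<in> o(\<lambda>n. real n powr (1 - \<delta>))"
    using A12 by blast
  define v where "v n = enn2real (L2_dist_sq p (nnet p (k n) (\<theta>0 n)) f0)" for n
  define S where "S n = (\<Sum>i<K n. (\<theta>0 n i)\<^sup>2)" for n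
  \<comment> \<open>The power is large enough for \<open>b n\<close> to be eventually at most 1 / n,
    as K and S are eventually at most n; raising it would change the divergence from the prior only
    by a constant factor in front of a logarithm.\<close>
  define t where "t n = 1 / real n ^ 4" for n
  define \<rho> where "\<rho> n = sqrt (v n) + 1 / real n" for n
  define b where "b n = (1 + sqrt (S n)) * K n * t n" for n
  define \<tau> where "\<tau> = min (\<epsilon> / 8) (1 / 2)"
  define \<eta> where "\<eta> = \<sigma>0 * sqrt (\<epsilon> * \<tau>) / 2"
  \<comment> \<open>This attains equality in the Lipschitz condition of \<open>sieve_event\<close>
    for a box of radius C = n.\<close>
  define h where "h n = \<eta> / ((1 + real n) * K n)" for n
  define F where "F n = space (param_space (K n)) - hellinger_nbhd p (k n) f0 \<sigma>0 \<epsilon>" for n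
  have v0: "0 \<le> v n" for n
    by (simp add: v_def)
  have S0: "0 \<le> S n" for n
    by (simp add: S_def sum_nonneg)
  have S_o: "S \<in> o(\<lambda>n. real n powr (1 - \<delta>))"
    using coeff by (simp add: S_def[abs_def] K_def)
  have K0: "0 < K n" for n
    by (simp add: K_def nparams_def)
  have \<eta>: "0 < \<eta>"
    using \<sigma>0 \<epsilon> by (simp add: \<eta>_def \<tau>_def)
  obtain c where c: "0 < c" and K_le: "\<forall>\<^sub>F n in at_top. real (K n) \<le> c * real n powr a"
    unfolding K_def using nparams_bigo[OF kn a(1)] by blast
  have "\<forall>\<^sub>F n in at_top. c * real n powr a \<le> real n"
    using a c by real_asymp
  with K_le have K_le_n: "\<forall>\<^sub>F n in at_top. real (K n) \<le> real n"
    by eventually_elim linarith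
  have b_le: "\<forall>\<^sub>F n in at_top. 0 \<le> b n \<and> b n \<le> 1 / real n"
  proof -
    have "\<forall>\<^sub>F n in at_top. norm (S n) \<le> 1 * norm (real n powr (1 - \<delta>))"
      using S_o by (rule landau_o.smallD) simp
    moreover have "\<forall>\<^sub>F n in at_top. (1 + sqrt (real n)) * real n * (1 / real n ^ 4) \<le> 1 / real n"
      by real_asymp
    ultimately show ?thesis
      using K_le_n eventually_ge_at_top[of 1]
    proof eventually_elim
      case (elim n)
      have "real n powr (1 - \<delta>) \<le> real n powr 1"
        using elim(4) \<delta> by (intro powr_mono) auto
      then have "S n \<le> real n"
        using elim(1,4) S0[of n] by simp
      then have "b n \<le> (1 + sqrt (real n)) * real n * (1 / real n ^ 4)"
        unfolding b_def t_def using elim(3) S0[of n] by (intro mult_right_mono mult_mono) auto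
      with elim(2) show ?case
        using S0[of n] by (simp add: b_def t_def)
    qed
  qed
  show ?thesis
    unfolding little_o_prob_def
  proof (intro allI impI)
    fix \<gamma> :: real assume \<gamma>: "0 < \<gamma>"
    \<comment> \<open>Three contributions of at most e * n powr (1 - \<delta>) arise: the
      deterministic loss, the level w, and ln (n + 1). Divided by n * \<epsilon> / 8 they total 3/4
      * \<gamma> * n powr (- \<delta>), strictly below the threshold.\<close>
    define e where "e = \<gamma> * \<epsilon> / 32"
    have e: "0 < e"
      using \<gamma> \<epsilon> by (simp add: e_def)
    \<comment> \<open>The probability bound of \<open>variational_posterior_bound\<close> with C =
      n, M = n and w = e * n powr (1 - \<delta>).\<close>
    define P where "P n = real n * (((1 + 1 / \<rho> n) * (2 * v n + 2 * (b n)\<^sup>2) + \<rho> n * \<sigma>0\<^sup>2) / (2 * \<sigma>0\<^sup>2)) / (e * real n powr (1 - \<delta>))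
        + 2 / real n + (2 * real n / h n + 3) ^ K n * exp (- (real n * \<epsilon> / 16))" for n
    have "P \<longlonglongrightarrow> 0 + 0 + 0"
      unfolding P_def[abs_def]
    proof (intro tendsto_add)
      show "(\<lambda>n. real n * (((1 + 1 / \<rho> n) * (2 * v n + 2 * (b n)\<^sup>2) + \<rho> n * \<sigma>0\<^sup>2) / (2 * \<sigma>0\<^sup>2)) / (e * real n powr (1 - \<delta>))) \<longlonglongrightarrow> 0"
        using approx a \<delta> by (intro rate_excess \<sigma>0 e v0 \<rho>_def b_le) (auto simp: v_def)
      show "(\<lambda>n. 2 / real n) \<longlonglongrightarrow> 0"
        by real_asymp
      show "(\<lambda>n. (2 * real n / h n + 3) ^ K n * exp (- (real n * \<epsilon> / 16))) \<longlonglongrightarrow> 0"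
        unfolding h_def using a c \<eta> \<epsilon> K_le K_le_n K0 by (rule rate_entropy)
    qed
    then have P: "P \<longlonglongrightarrow> 0"
      by simp
    let ?X = "\<lambda>n D. measure (qstar n D) (space (param_space (nparams p (k n))) - hellinger_nbhd p (k n) f0 \<sigma>0 \<epsilon>) / real n powr (- \<delta>)"
    let ?A = "\<lambda>n. {D \<in> space (true_data_measure p f0 \<sigma>0 n). \<gamma> \<le> \<bar>?X n D\<bar>}"
    have loss: "\<forall>\<^sub>F n in at_top. K n * ln (\<zeta> / t n) + (K n * (t n)\<^sup>2 + S n) / (2 * \<zeta>\<^sup>2) \<le> e * real n powr (1 - \<delta>)"
      unfolding t_def using K_le by (intro rate_bound_loss[OF a(1) \<delta> \<zeta> c e _ _ S_o]) auto
    have tail: "\<forall>\<^sub>F n in at_top. exp (n * \<epsilon> / 8) * (K n * (sqrt 2 * exp (- (real n)\<^sup>2 / (4 * \<zeta>\<^sup>2)))) \<le> 1"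
      using rate_tail[OF \<zeta> \<epsilon> K_le_n] by simp
    have logn: "\<forall>\<^sub>F n in at_top. ln (real n + 1) \<le> e * real n powr (1 - \<delta>)"
      using a \<delta> e by real_asymp
    have bound: "\<forall>\<^sub>F n in at_top. outer_prob (true_data_measure p f0 \<sigma>0 n) (?A n) \<le> P n"
      using fin loss tail logn eventually_ge_at_top[of 1]
    proof eventually_elim
      case (elim n)
      have n: "0 < real n"
        using elim(5) by simp
      have L2: "L2_dist_sq p (nnet p (k n) (\<theta>0 n)) f0 = ennreal (v n)"
        using elim(1) by (simp add: v_def)
      \<comment> \<open>The Euclidean norm of the coefficients serves as the uniform bound B, which
        is how (A2) enters the Lipschitz constant.\<close>
      have \<theta>0_le: "\<bar>\<theta>0 n j\<bar> \<le> sqrt (S n)" if "j < K n" for j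
      proof -
        have "(\<theta>0 n j)\<^sup>2 \<le> S n"
          unfolding S_def using that by (intro member_le_sum) auto
        then show ?thesis
          using real_le_rsqrt[of "\<bar>\<theta>0 n j\<bar>" "S n"] by simp
      qed
      have h: "0 < h n" "(1 + real n) * (K n * h n) \<le> \<sigma>0 * sqrt (\<epsilon> * \<tau>) / 2"
        using \<eta> K0[of n] unfolding \<eta>_def[symmetric] by (auto simp: h_def)
      have pos: "0 < t n" "0 < \<rho> n" "0 < e * real n powr (1 - \<delta>)"
        using n e v0[of n] by (auto simp: t_def \<rho>_def intro!: add_nonneg_pos)
      obtain E where E: "E \<in> sets (true_data_measure p f0 \<sigma>0 n)"
        "measure (true_data_measure p f0 \<sigma>0 n) E \<le> P n"
        "\<And>D. D \<in> space (true_data_measure p f0 \<sigma>0 n) - E \<Longrightarrow> n * \<epsilon> / 8 * measure (qstar n D) (F n)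
          \<le> K n * ln (\<zeta> / t n) + (K n * (t n)\<^sup>2 + S n) / (2 * \<zeta>\<^sup>2) + e * real n powr (1 - \<delta>) + ln (real n + 1)"
        using variational_posterior_bound[OF \<zeta> \<epsilon> pos(1,2) _ n pos(3) \<tau>_def h(1) h(2)[unfolded K_def] L2 v0
            \<theta>0_le[unfolded K_def] elim(3)[unfolded K_def] qstar]
        unfolding P_def b_def S_def F_def K_def by auto
      have "?A n \<subseteq> E"
      proof
        fix D assume D: "D \<in> ?A n"
        show "D \<in> E"
        proof (rule ccontr)
          assume "D \<notin> E"
          with D have "n * \<epsilon> / 8 * measure (qstar n D) (F n)
              \<le> K n * ln (\<zeta> / t n) + (K n * (t n)\<^sup>2 + S n) / (2 * \<zeta>\<^sup>2) + e * real n powr (1 - \<delta>) + ln (real n + 1)"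
            by (intro E(3)) auto
          also have "\<dots> \<le> 3 * e * real n powr (1 - \<delta>)"
            using elim(2,4) by linarith
          also have "\<dots> = n * \<epsilon> / 8 * (3 / 4 * \<gamma> * real n powr (- \<delta>))"
            using n by (simp add: e_def powr_diff powr_minus_divide)
          finally have "measure (qstar n D) (F n) \<le> 3 / 4 * \<gamma> * real n powr (- \<delta>)"
            using n \<epsilon> by (subst (asm) mult_le_cancel_left_pos) auto
          moreover have "\<gamma> * real n powr (- \<delta>) \<le> measure (qstar n D) (F n)"
            using D n by (simp add: F_def K_def pos_le_divide_eq)
          moreover have "0 < \<gamma> * real n powr (- \<delta>)"
            using \<gamma> n by simp
          ultimately show False
            by linarith
        qed
      qed
      then show ?case
        using outer_prob_le[OF E(1)] E(2) by (meson order_trans)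
    qed
    show "(\<lambda>n. outer_prob (true_data_measure p f0 \<sigma>0 n) (?A n)) \<longlonglongrightarrow> 0"
      by (rule tendsto_sandwich[OF _ bound tendsto_const P])
        (auto intro!: always_eventually outer_prob_nonneg)
  qed
qed

end
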